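(* Given a nondegenerate hyperquadric $M\subset\mathbb C^{n+1}$, there exist a Levi nondegenerate hypersurface $M'\subset\mathbb C^{2n+2}$ and a polynomial embedding $H\colon\mathbb C^{n+1}\to\mathbb C^{2n+2}$ of degree $2$ such that $H$ sends $M$ into $M'$, but neither of the following holds: (i) there is an open subset $V\subset\mathbb C^{n+1}$ with $M\subset V$ and $H(V)\subset M'$; (ii) $H$ is transversal to $M'$ at $H(p)$ for all $p\in M$ outside a proper real-analytic subset of $M$. More precisely, let $M:=\{Z\in\mathbb C^{n+1}:\rho(Z,\bar Z)=0\}$ with $$\rho(Z,\bar Z):=\operatorname{Im} w-\sum_{j=1}^n\delta_j|z_j|^2,\qquad Z=(z,w)\in\mathbb C^n\times\mathbb C,$$ where $\delta_j=\pm1$, and let $\langle\cdot,\bar\cdot\rangle$ be a nondegenerate hermitian form in $\mathbb C^{2n+1}$ with $n$ negative and $n+1$ positive eigenvalues. Then there exist a polynomial embedding $H\colon\mathbb C^{n+1}\to\mathbb C^{2n+2}$ of degree two and a real bihomogeneous polynomial $\phi(z',\bar z')$, $z'\in\mathbb C^{2n+1}$, of bidegree $(2,2)$, such that if $$\rho'(z',w',\bar z',\bar w'):=\operatorname{Im} w'-\langle z',\bar z'\rangle-\phi(z',\bar z'),\qquad (z',w')\in\mathbb C^{2n+1}\times\mathbb C,$$ then $\rho'\circ H=-4\rho^2$.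
   Context: A hyperquadric in $\mathbb C^{n+1}$ is a real-algebraic hypersurface defined by $\operatorname{Im} w=\langle z,\bar z\rangle$, $(z,w)\in\mathbb C^n\times\mathbb C$, where $\langle\cdot,\bar\cdot\rangle$ is a hermitian form in $\mathbb C^n$; it is nondegenerate if the form is nondegenerate. A real hypersurface is Levi nondegenerate if its Levi form has no zero eigenvalue at any point. If $H\colon\mathbb C^{n+1}\to\mathbb C^{N}$ is a holomorphic mapping and $M'\subset\mathbb C^N$ is a real hypersurface through $H(p)$, then $H$ is transversal to $M'$ at $H(p)$ if $T_{H(p)}M'+dH(T_p\mathbb C^{n+1})=T_{H(p)}\mathbb C^{N}$ (real tangent spaces; $dH$ taken at $p$). Here $\rho'\circ H$ denotes the function $Z\mapsto\rho'(H(Z),\overline{H(Z)})$. A polynomial $\phi(z',\bar z')$ is bihomogeneous of bidegree $(2,2)$ if it is homogeneous of degree $2$ in $z'$ and homogeneous of degree $2$ in $\bar z'$; it is real if it is real-valued. *)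

theory Defs
  imports "HOL-Analysis.Analysis"
begin

text \<open>
  The space \<open>\<complex>\<^sup>n\<^sup>+\<^sup>1 = \<complex>\<^sup>n \<times> \<complex>\<close> is the type \<^typ>\<open>(complex^'n) \<times> complex\<close>, with points
  \<open>(z, w)\<close>. It is a real Euclidean space of dimension \<open>2n + 2\<close>; the product type carries no complex
  scalar multiplication in the library, so that one is supplied by \<open>cscale\<close>.
\<close>

definition cscale :: "complex \<Rightarrow> (complex^'n) \<times> complex \<Rightarrow> (complex^'n) \<times> complex" where
  "cscale c Z = (c *s fst Z, c * snd Z)"

definition cdot :: "(complex^'n) \<times> complex \<Rightarrow> (complex^'n) \<times> complex \<Rightarrow> complex" where
  "cdot X Y = (\<Sum>i\<in>UNIV. fst X $ i * cnj (fst Y $ i)) + snd X * cnj (snd Y)"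

text \<open>A form \<open>h\<close> is linear in its first and antilinear in its second argument, so
  \<open>\<langle>z, \<zeta>-bar\<rangle>\<close> is \<open>h z \<zeta>\<close>. The value \<open>h z z\<close> is real; \<^const>\<open>Re\<close> is used below only to turn it
  into an element of type \<^typ>\<open>real\<close>.\<close>

definition hermitian_form :: "(complex^'n \<Rightarrow> complex^'n \<Rightarrow> complex) \<Rightarrow> bool" where
  "hermitian_form h \<longleftrightarrow>
     (\<forall>x y u. h (x + y) u = h x u + h y u) \<and>
     (\<forall>c x u. h (c *s x) u = c * h x u) \<and>
     (\<forall>x u. h u x = cnj (h x u))"

definition nondegenerate_form :: "(complex^'n \<Rightarrow> complex^'n \<Rightarrow> complex) \<Rightarrow> bool" where
  "nondegenerate_form h \<longleftrightarrow> (\<forall>x. (\<forall>u. h x u = 0) \<longrightarrow> x = 0)"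

text \<open>The matrix \<open>A\<close> of the form, normalised so that \<open>h x u\<close> is the standard hermitian product of
  \<open>A x\<close> and \<open>u\<close>.\<close>

definition form_matrix :: "(complex^'n \<Rightarrow> complex^'n \<Rightarrow> complex) \<Rightarrow> complex^'n^'n" where
  "form_matrix h = (\<chi> i j. h (axis j 1) (axis i 1))"

definition eigenspace :: "complex^'n^'n \<Rightarrow> real \<Rightarrow> (complex^'n) set" where
  "eigenspace A \<mu> = {v. A *v v = complex_of_real \<mu> *s v}"

text \<open>Number of eigenvalues of \<open>h\<close> in \<open>S\<close>, counted with multiplicity (the complex dimension of the
  eigenspace).\<close>

definition eigenvalue_count :: "(complex^'n \<Rightarrow> complex^'n \<Rightarrow> complex) \<Rightarrow> real set \<Rightarrow> nat" where
  "eigenvalue_count h S =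
     (\<Sum>\<mu> | \<mu> \<in> S \<and> eigenspace (form_matrix h) \<mu> \<noteq> {0}. vec.dim (eigenspace (form_matrix h) \<mu>))"

definition hyperquadric :: "(complex^'n \<Rightarrow> complex^'n \<Rightarrow> complex) \<Rightarrow> ((complex^'n) \<times> complex) set" where
  "hyperquadric h = {(z, w). Im w = Re (h z z)}"

definition zmonom :: "('n \<Rightarrow> nat) \<Rightarrow> complex^'n \<Rightarrow> complex" where
  "zmonom \<alpha> z = (\<Prod>i\<in>UNIV. (z $ i) ^ \<alpha> i)"

definition poly_fun_le :: "nat \<Rightarrow> ((complex^'n) \<times> complex \<Rightarrow> complex) \<Rightarrow> bool" where
  "poly_fun_le d f \<longleftrightarrow>
     (\<exists>c. \<forall>z w. f (z, w) =
        (\<Sum>(\<alpha>, k) | sum \<alpha> UNIV + k \<le> d. c \<alpha> k * zmonom \<alpha> z * w ^ k))"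

definition poly_map_le :: "nat \<Rightarrow> ((complex^'n) \<times> complex \<Rightarrow> (complex^'m) \<times> complex) \<Rightarrow> bool" where
  "poly_map_le d H \<longleftrightarrow>
     (\<forall>i. poly_fun_le d (\<lambda>Z. fst (H Z) $ i)) \<and> poly_fun_le d (\<lambda>Z. snd (H Z))"

definition poly_map_of_degree ::
    "nat \<Rightarrow> ((complex^'n) \<times> complex \<Rightarrow> (complex^'m) \<times> complex) \<Rightarrow> bool" where
  "poly_map_of_degree d H \<longleftrightarrow> poly_map_le d H \<and> (\<forall>e<d. \<not> poly_map_le e H)"

text \<open>Reality of the polynomial is built into the type of \<open>\<phi>\<close>.\<close>

definition real_bihomogeneous :: "nat \<Rightarrow> nat \<Rightarrow> (complex^'m \<Rightarrow> real) \<Rightarrow> bool" where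
  "real_bihomogeneous d e \<phi> \<longleftrightarrow>
     (\<exists>c. \<forall>z. complex_of_real (\<phi> z) =
        (\<Sum>(\<alpha>, \<beta>) | sum \<alpha> UNIV = d \<and> sum \<beta> UNIV = e. c \<alpha> \<beta> * zmonom \<alpha> z * cnj (zmonom \<beta> z)))"

lemma finite_multiindices: "finite {\<alpha> :: 'n::finite \<Rightarrow> nat. sum \<alpha> UNIV \<le> d}"
proof (rule finite_subset)
  show "{\<alpha> :: 'n \<Rightarrow> nat. sum \<alpha> UNIV \<le> d} \<subseteq> PiE UNIV (\<lambda>_. {..d})"
  proof
    fix \<alpha> :: "'n \<Rightarrow> nat"
    assume "\<alpha> \<in> {\<alpha>. sum \<alpha> UNIV \<le> d}"
    then have "\<alpha> i \<le> d" for i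
      using member_le_sum[of i UNIV \<alpha>] by simp
    then show "\<alpha> \<in> PiE UNIV (\<lambda>_. {..d})" by (simp add: PiE_iff)
  qed
  show "finite (PiE (UNIV :: 'n set) (\<lambda>_. {..d}))"
    by (intro finite_PiE) auto
qed

lemma finite_poly_indices: "finite {(\<alpha> :: 'n::finite \<Rightarrow> nat, k). sum \<alpha> UNIV + k \<le> d}"
  by (rule finite_subset[OF _ finite_cartesian_product[OF finite_multiindices[of d] finite_atMost[of d]]])
     auto

lemma finite_bihomogeneous_indices:
  "finite {(\<alpha> :: 'n::finite \<Rightarrow> nat, \<beta> :: 'n \<Rightarrow> nat). sum \<alpha> UNIV = d \<and> sum \<beta> UNIV = e}"
  by (rule finite_subset[OF _ finite_cartesian_product[OF finite_multiindices[of d]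
        finite_multiindices[of e]]]) auto

definition embedding :: "('a::real_normed_vector \<Rightarrow> 'b::real_normed_vector) \<Rightarrow> bool" where
  "embedding H \<longleftrightarrow>
     (\<forall>p. H differentiable (at p) \<and> inj (frechet_derivative H (at p))) \<and>
     (\<exists>G. homeomorphism UNIV (range H) H G)"

primrec Ck_on :: "nat \<Rightarrow> 'a::real_normed_vector set \<Rightarrow> ('a \<Rightarrow> real) \<Rightarrow> bool" where
  "Ck_on 0 U f \<longleftrightarrow> continuous_on U f"
| "Ck_on (Suc k) U f \<longleftrightarrow>
     (\<forall>x\<in>U. f differentiable (at x)) \<and> (\<forall>v. Ck_on k U (\<lambda>x. frechet_derivative f (at x) v))"

definition smooth_on :: "'a::real_normed_vector set \<Rightarrow> ('a \<Rightarrow> real) \<Rightarrow> bool" where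
  "smooth_on U f \<longleftrightarrow> (\<forall>k. Ck_on k U f)"

definition local_defining ::
    "'a::real_normed_vector set \<Rightarrow> 'a \<Rightarrow> 'a set \<Rightarrow> ('a \<Rightarrow> real) \<Rightarrow> bool" where
  "local_defining M q U r \<longleftrightarrow>
     open U \<and> q \<in> U \<and> smooth_on U r \<and>
     (\<forall>x\<in>U. \<exists>v. frechet_derivative r (at x) v \<noteq> 0) \<and>
     M \<inter> U = {x\<in>U. r x = 0}"

definition real_hypersurface :: "'a::real_normed_vector set \<Rightarrow> bool" where
  "real_hypersurface M \<longleftrightarrow> (\<forall>q\<in>M. \<exists>U r. local_defining M q U r)"

text \<open>The real tangent space, as the set of velocities at \<open>q\<close> of curves in \<open>M\<close>.\<close>

definition tangent_space :: "'a::real_normed_vector set \<Rightarrow> 'a \<Rightarrow> 'a set" where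
  "tangent_space M q =
     {v. \<exists>\<gamma> :: real \<Rightarrow> 'a. \<gamma> 0 = q \<and> range \<gamma> \<subseteq> M \<and> (\<gamma> has_vector_derivative v) (at 0)}"

definition transversal_at ::
    "('a::real_normed_vector \<Rightarrow> 'b::real_normed_vector) \<Rightarrow> 'b set \<Rightarrow> 'a \<Rightarrow> bool" where
  "transversal_at H M' p \<longleftrightarrow>
     {a + b | a b. a \<in> tangent_space M' (H p) \<and> b \<in> range (frechet_derivative H (at p))} = UNIV"

text \<open>\<open>del v g\<close> is \<open>\<Sum>\<^sub>j v\<^sub>j \<partial>g/\<partial>Z\<^sub>j\<close> and \<open>delbar u g\<close> is \<open>\<Sum>\<^sub>j u\<^sub>j-bar \<partial>g/\<partial>Z\<^sub>j-bar\<close>.\<close>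

definition del ::
    "(complex^'n) \<times> complex \<Rightarrow> ((complex^'n) \<times> complex \<Rightarrow> complex) \<Rightarrow> (complex^'n) \<times> complex \<Rightarrow> complex" where
  "del v g p = (frechet_derivative g (at p) v - \<i> * frechet_derivative g (at p) (cscale \<i> v)) / 2"

definition delbar ::
    "(complex^'n) \<times> complex \<Rightarrow> ((complex^'n) \<times> complex \<Rightarrow> complex) \<Rightarrow> (complex^'n) \<times> complex \<Rightarrow> complex" where
  "delbar u g p = (frechet_derivative g (at p) u + \<i> * frechet_derivative g (at p) (cscale \<i> u)) / 2"

text \<open>The \<open>(1,0)\<close>-tangent space at \<open>q\<close> of the hypersurface with local defining function \<open>r\<close>, and the
  Levi form \<open>\<Sum>\<^sub>j\<^sub>k r\<^sub>j\<^sub>k-bar v\<^sub>j u\<^sub>k-bar\<close> on it.\<close>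

definition holo_tangent :: "((complex^'n) \<times> complex \<Rightarrow> real) \<Rightarrow> (complex^'n) \<times> complex \<Rightarrow> ((complex^'n) \<times> complex) set" where
  "holo_tangent r q = {v. del v (\<lambda>x. complex_of_real (r x)) q = 0}"

definition levi_form ::
    "((complex^'n) \<times> complex \<Rightarrow> real) \<Rightarrow> (complex^'n) \<times> complex \<Rightarrow>
     (complex^'n) \<times> complex \<Rightarrow> (complex^'n) \<times> complex \<Rightarrow> complex" where
  "levi_form r q v u = del v (delbar u (\<lambda>x. complex_of_real (r x))) q"

definition levi_eigenvalue :: "((complex^'n) \<times> complex \<Rightarrow> real) \<Rightarrow> (complex^'n) \<times> complex \<Rightarrow> real \<Rightarrow> bool" where
  "levi_eigenvalue r q \<mu> \<longleftrightarrow>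
     (\<exists>v\<in>holo_tangent r q. v \<noteq> 0 \<and>
        (\<forall>u\<in>holo_tangent r q. levi_form r q v u = complex_of_real \<mu> * cdot v u))"

text \<open>Changing the local defining function multiplies the Levi form by a nonzero real factor, so it
  does not matter for a zero eigenvalue which one is used.\<close>

definition levi_nondegenerate :: "((complex^'n) \<times> complex) set \<Rightarrow> bool" where
  "levi_nondegenerate M \<longleftrightarrow>
     real_hypersurface M \<and>
     (\<forall>q\<in>M. \<exists>U r. local_defining M q U r \<and> \<not> levi_eigenvalue r q 0)"

text \<open>Local expansion into a convergent power series in the real coordinates; a multi-index is a
  function \<open>\<alpha>\<close> supported on \<^const>\<open>Basis\<close>.\<close>

definition real_analytic_at :: "('a::euclidean_space \<Rightarrow> real) \<Rightarrow> 'a \<Rightarrow> bool" where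
  "real_analytic_at f p \<longleftrightarrow>
     (\<exists>c. \<exists>e>0. \<forall>x\<in>ball p e.
        ((\<lambda>\<alpha>. c \<alpha> * (\<Prod>b\<in>Basis. ((x - p) \<bullet> b) ^ \<alpha> b)) has_sum f x)
          {\<alpha> :: 'a \<Rightarrow> nat. \<forall>b. b \<notin> Basis \<longrightarrow> \<alpha> b = 0})"

text \<open>For a real-analytic submanifold \<open>M\<close>, such as a hyperquadric, real-analytic functions on \<open>M\<close>
  are locally restrictions of real-analytic functions on the ambient space.\<close>

definition real_analytic_subset :: "'a::euclidean_space set \<Rightarrow> 'a set \<Rightarrow> bool" where
  "real_analytic_subset A M \<longleftrightarrow>
     A \<subseteq> M \<and>
     (\<forall>p\<in>M. \<exists>U F. open U \<and> p \<in> U \<and> finite F \<and> (\<forall>f\<in>F. \<forall>x\<in>U. real_analytic_at f x) \<and>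
        A \<inter> U = {x\<in>M \<inter> U. \<forall>f\<in>F. f x = 0})"

definition rho :: "('n \<Rightarrow> real) \<Rightarrow> (complex^'n) \<times> complex \<Rightarrow> real" where
  "rho \<delta> = (\<lambda>(z, w). Im w - (\<Sum>j\<in>UNIV. \<delta> j * (cmod (z $ j))\<^sup>2))"

definition rho' ::
    "(complex^'m \<Rightarrow> complex^'m \<Rightarrow> complex) \<Rightarrow> (complex^'m \<Rightarrow> real) \<Rightarrow> (complex^'m) \<times> complex \<Rightarrow> real" where
  "rho' h \<phi> = (\<lambda>(z, w). Im w - Re (h z z) - \<phi> z)"

end

theory Submission
  imports Defs
begin

text \<open>
  Write \<open>2\<i>\<rho> = w - w-bar - 2\<i>\<langle>z, z\<rangle>\<close>. Squaring gives
  \<open>-4\<rho>\<^sup>2 = Im (2\<i> w\<^sup>2) - (4\<i>\<langle>z, z\<rangle>(w - w-bar) + 2|w|\<^sup>2) - 4\<langle>z, z\<rangle>\<^sup>2\<close>. The middle term is the value at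
  \<open>(x, y, r) = (z, w z, w)\<close> of the hermitian form
  \<open>4\<i>(\<langle>y, x\<rangle> - \<langle>x, y\<rangle>) + 2|r|\<^sup>2\<close>, which has signature \<open>(n + 1, n)\<close>, and the last one is
  \<open>\<phi> = 4\<langle>x, x\<rangle>\<^sup>2\<close>. The Levi form of the target is this form plus a term involving only \<open>x\<close>, so
  its matrix is block anti-triangular with invertible blocks at every point. Since \<open>\<rho>' \<circ> H = -4\<rho>\<^sup>2\<close>
  vanishes to second order along \<open>M\<close>, the map is nowhere transversal.

  To bring a given form into the shape above, no spectral theorem is needed: eigenspaces for
  distinct eigenvalues are orthogonal, and the prescribed eigenvalue counts add up to the full
  dimension.
\<close>

section \<open>Polynomials are smooth\<close>

text \<open>Induction over the way polynomial functions are built. The derivative in a fixed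
  direction is again polynomial, which lets the recursion of \<open>Ck_on\<close> be
  iterated.\<close>

lemma real_polynomial_function_derivative:
  assumes "real_polynomial_function f"
  obtains D where "\<And>x. (f has_derivative D x) (at x)" "\<And>v. real_polynomial_function (\<lambda>x. D x v)"
  using assms
proof (induction arbitrary: thesis rule: real_polynomial_function.induct)
  case (linear f)
  show ?case
    by (rule linear.prems[of "\<lambda>_. f"])
       (rule bounded_linear_imp_has_derivative linear.hyps real_polynomial_function.intros(2))+
next
  case (const c)
  show ?case
    by (rule const.prems[of "\<lambda>_ _. 0"])
       (rule has_derivative_const real_polynomial_function.intros(2))+
next
  case (add f g)
  obtain D where D: "\<And>x. (f has_derivative D x) (at x)" "\<And>v. real_polynomial_function (\<lambda>x. D x v)"
    using add.IH(1) by blast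
  obtain E where E: "\<And>x. (g has_derivative E x) (at x)" "\<And>v. real_polynomial_function (\<lambda>x. E x v)"
    using add.IH(2) by blast
  show ?case
    by (rule add.prems[of "\<lambda>x v. D x v + E x v"])
       (intro has_derivative_add real_polynomial_function.intros(3) D E)+
next
  case (mult f g)
  obtain D where D: "\<And>x. (f has_derivative D x) (at x)" "\<And>v. real_polynomial_function (\<lambda>x. D x v)"
    using mult.IH(1) by blast
  obtain E where E: "\<And>x. (g has_derivative E x) (at x)" "\<And>v. real_polynomial_function (\<lambda>x. E x v)"
    using mult.IH(2) by blast
  show ?case
    by (rule mult.prems[of "\<lambda>x v. f x * E x v + D x v * g x"])
       (intro has_derivative_mult real_polynomial_function.intros(3,4) mult.hyps D E)+
qed

lemma smooth_on_real_polynomial_function: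
  assumes "real_polynomial_function f"
  shows "smooth_on U f"
proof -
  have "Ck_on k U f" for k
    using assms
  proof (induction k arbitrary: f)
    case 0
    then show ?case
      by (simp add: continuous_on_polymonial_function real_polynomial_function_eq)
  next
    case (Suc k)
    then obtain D where D: "\<And>x. (f has_derivative D x) (at x)"
      "\<And>v. real_polynomial_function (\<lambda>x. D x v)"
      using real_polynomial_function_derivative[OF Suc.prems] by blast
    have "frechet_derivative f (at x) = D x" for x
      using frechet_derivative_at[OF D(1)] by simp
    with D Suc.IH show ?case
      by (auto simp: differentiable_def)
  qed
  then show ?thesis
    by (simp add: smooth_on_def)
qed

text \<open>Expanding both arguments in the standard basis leaves products of two coordinates with
  constant coefficients. This supplies the real parts of hermitian forms as polynomial
  functions.\<close>

lemma real_polynomial_function_bilinear: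
  fixes b :: "'a::euclidean_space \<Rightarrow> 'a \<Rightarrow> real"
  assumes "bilinear b"
  shows "real_polynomial_function (\<lambda>x. b x x)"
proof -
  have expand: "b x x = (\<Sum>i\<in>Basis. \<Sum>j\<in>Basis. (x \<bullet> i) * ((x \<bullet> j) * b i j))" for x
  proof -
    have "b x x = b (\<Sum>i\<in>Basis. (x \<bullet> i) *\<^sub>R i) (\<Sum>j\<in>Basis. (x \<bullet> j) *\<^sub>R j)"
      by (simp add: euclidean_representation)
    also have "\<dots> = (\<Sum>i\<in>Basis. \<Sum>j\<in>Basis. (x \<bullet> i) * ((x \<bullet> j) * b i j))"
      by (simp add: bilinear_sum[OF assms] sum.cartesian_product
          bilinear_lmul[OF assms] bilinear_rmul[OF assms] mult.left_commute)
    finally show ?thesis .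
  qed
  show ?thesis
    unfolding expand
    by (intro real_polynomial_function_sum finite_Basis real_polynomial_function.intros(4)
        real_polynomial_function.intros(2) real_polynomial_function.intros(1) bounded_linear_inner_left)
qed

section \<open>Hermitian forms\<close>

text \<open>Bridge between the complex scalar multiplication, in which forms and coordinates are
  linear, and the real one, on which derivatives rest.\<close>

lemma scaleR_eq_scalar_mult: "r *\<^sub>R (x :: complex^'n) = complex_of_real r *s x"
  by (simp only: vec_eq_iff vector_scaleR_component vector_smult_component) (simp add: scaleR_conv_of_real)

lemma hermitian_form_simps:
  assumes "hermitian_form h"
  shows "h (x + y) u = h x u + h y u" "h u (x + y) = h u x + h u y"
    "h (c *s x) u = c * h x u" "h u (c *s x) = cnj c * h u x"
    "h 0 u = 0" "h u 0 = 0"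
    "h (- x) u = - h x u" "h u (- x) = - h u x"
    "h (x - y) u = h x u - h y u" "h u (x - y) = h u x - h u y"
proof -
  have cnj: "h a b = cnj (h b a)" and add: "h (a + b) u = h a u + h b u"
    and scale: "h (c *s a) u = c * h a u" for a b c u
    using assms[unfolded hermitian_form_def] by meson+
  have zero: "h 0 u = 0" for u
    using scale[of 0 0 u] by simp
  have minus: "h (- x) u = - h x u" for x u
    using scale[of "-1" x u] by simp
  have diff: "h (x - y) u = h x u - h y u" for x y u
    using add[of x "-y" u] minus by simp
  show "h (x + y) u = h x u + h y u" "h u (x + y) = h u x + h u y"
    "h (c *s x) u = c * h x u" "h u (c *s x) = cnj c * h u x"
    "h 0 u = 0" "h u 0 = 0"
    "h (- x) u = - h x u" "h u (- x) = - h u x"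
    "h (x - y) u = h x u - h y u" "h u (x - y) = h u x - h u y"
    by (simp_all add: add scale zero minus diff cnj[of u])
qed

lemma hermitian_form_cnj: "hermitian_form h \<Longrightarrow> h x u = cnj (h u x)"
  by (metis hermitian_form_def)

lemma hermitian_form_diag: "hermitian_form h \<Longrightarrow> h x x = complex_of_real (Re (h x x))"
  by (metis Reals_cnj_iff hermitian_form_cnj of_real_Re)

lemma hermitian_form_sum:
  assumes "hermitian_form h"
  shows "h (\<Sum>i\<in>I. f i) u = (\<Sum>i\<in>I. h (f i) u)" "h u (\<Sum>i\<in>I. f i) = (\<Sum>i\<in>I. h u (f i))"
  by (induction I rule: infinite_finite_induct) (simp_all add: hermitian_form_simps[OF assms])

lemma vec_eq_sum_axis: "z = (\<Sum>i\<in>UNIV. (z $ i) *s axis i (1::complex))"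
  by (simp add: vec_eq_iff axis_def if_distrib cong: if_cong)

lemma hermitian_form_expand:
  assumes "hermitian_form h"
  shows "h z u = (\<Sum>i\<in>UNIV. \<Sum>j\<in>UNIV. z $ i * (cnj (u $ j) * h (axis i 1) (axis j 1)))"
  by (subst (1) vec_eq_sum_axis[of z], subst (1) vec_eq_sum_axis[of u])
     (simp add: hermitian_form_sum[OF assms] hermitian_form_simps[OF assms] sum_distrib_left mult_ac, rule sum.swap)

text \<open>A sesquilinear form is bilinear over the reals, and finite dimension makes it bounded.
  The product rule for derivatives then applies to it.\<close>

lemma bounded_bilinear_hermitian_form:
  assumes "hermitian_form h"
  shows "bounded_bilinear h"
  unfolding bilinear_conv_bounded_bilinear[symmetric] bilinear_def
  by (auto intro!: linearI
      simp: hermitian_form_simps[OF assms] scaleR_eq_scalar_mult scaleR_conv_of_real)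

section \<open>The Levi form of a quartic graph\<close>

lemma real_polynomial_function_rho':
  fixes h k :: "complex^'m \<Rightarrow> complex^'m \<Rightarrow> complex"
  assumes h: "hermitian_form h" and k: "hermitian_form k"
  shows "real_polynomial_function (rho' h (\<lambda>z. 4 * (Re (k z z))\<^sup>2))"
proof -
  have quad: "real_polynomial_function (\<lambda>q :: (complex^'m) \<times> complex. Re (h (fst q) (fst q)))"
    if "hermitian_form h" for h
  proof -
    have "bilinear (\<lambda>p q :: (complex^'m) \<times> complex. Re (h (fst p) (fst q)))"
      unfolding bilinear_def
      by (auto intro!: linearI
          simp: hermitian_form_simps[OF that] scaleR_eq_scalar_mult)
    then show ?thesis
      by (rule real_polynomial_function_bilinear)
  qed
  have "rho' h (\<lambda>z. 4 * (Re (k z z))\<^sup>2) =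
      (\<lambda>q. Im (snd q) - Re (h (fst q) (fst q)) - 4 * (Re (k (fst q) (fst q)))\<^sup>2)"
    by (auto simp: rho'_def)
  moreover have "real_polynomial_function \<dots>"
    by (intro real_polynomial_function_diff real_polynomial_function.intros(4)
        real_polynomial_function.intros(2) real_polynomial_function_power quad h k
        real_polynomial_function.intros(1))
       (auto intro: bounded_linear_compose[OF bounded_linear_Im] bounded_linear_snd)
  ultimately show ?thesis
    by simp
qed

text \<open>By hermitian symmetry the two terms of the product rule have equal real parts, hence the
  factor 2 at \<open>h\<close>; the quartic term gives 16 = 4 * 2 * 2.\<close>

lemma has_derivative_rho':
  fixes h k :: "complex^'m \<Rightarrow> complex^'m \<Rightarrow> complex"
  assumes h: "hermitian_form h" and k: "hermitian_form k"
  shows "(rho' h (\<lambda>z. 4 * (Re (k z z))\<^sup>2) has_derivative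
    (\<lambda>v. Im (snd v) - 2 * Re (h (fst v) (fst q)) - 16 * Re (k (fst q) (fst q)) * Re (k (fst v) (fst q))))
    (at q)"
proof -
  have quad: "((\<lambda>q. h (fst q) (fst q)) has_derivative (\<lambda>v. h (fst q) (fst v) + h (fst v) (fst q))) (at q)"
    if "hermitian_form h" for h and q :: "(complex^'m) \<times> complex"
    by (rule bounded_bilinear.FDERIV[OF bounded_bilinear_hermitian_form[OF that]])
       (rule has_derivative_fst has_derivative_ident)+
  have sym: "Re (h a b) = Re (h b a)" if "hermitian_form h" for h a b
    using hermitian_form_cnj[OF that, of a] by simp
  have "rho' h (\<lambda>z. 4 * (Re (k z z))\<^sup>2) =
      (\<lambda>q. Im (snd q) - Re (h (fst q) (fst q)) - 4 * (Re (k (fst q) (fst q)))\<^sup>2)"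
    by (auto simp: rho'_def)
  moreover have "(\<dots> has_derivative
    (\<lambda>v. Im (snd v) - 2 * Re (h (fst v) (fst q)) - 16 * Re (k (fst q) (fst q)) * Re (k (fst v) (fst q))))
    (at q)"
    by (rule derivative_eq_intros quad[OF h] quad[OF k] refl)+
       (simp add: sym[OF h] sym[OF k] mult_ac)
  ultimately show ?thesis
    by simp
qed

text \<open>The derivative is \<open>2 * Re (L v)\<close> with \<open>L\<close> complex linear,
  where the vertical term enters as \<open>Im s = 2 * Re (- \<i> * s / 2)\<close>. So
  \<open>del\<close> returns \<open>L v\<close> and \<open>delbar\<close> its conjugate.\<close>

lemma del_rho':
  fixes h k :: "complex^'m \<Rightarrow> complex^'m \<Rightarrow> complex"
  assumes h: "hermitian_form h" and k: "hermitian_form k"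
  shows "del v (\<lambda>x. complex_of_real (rho' h (\<lambda>z. 4 * (Re (k z z))\<^sup>2) x)) q =
      - \<i> * snd v / 2 - h (fst v) (fst q) - 8 * k (fst q) (fst q) * k (fst v) (fst q)"
    and "delbar v (\<lambda>x. complex_of_real (rho' h (\<lambda>z. 4 * (Re (k z z))\<^sup>2) x)) q =
      \<i> * cnj (snd v) / 2 - h (fst q) (fst v) - 8 * k (fst q) (fst q) * k (fst q) (fst v)"
proof -
  note D = frechet_derivative_at[OF has_derivative_of_real[OF has_derivative_rho'[OF h k]], symmetric]
  have c: "h (fst q) (fst v) = cnj (h (fst v) (fst q))" "k (fst q) (fst v) = cnj (k (fst v) (fst q))"
    "Im (k (fst q) (fst q)) = 0"
    using hermitian_form_cnj[OF h] hermitian_form_cnj[OF k] hermitian_form_diag[OF k, of "fst q"]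
    by (metis Im_complex_of_real)+
  show "del v (\<lambda>x. complex_of_real (rho' h (\<lambda>z. 4 * (Re (k z z))\<^sup>2) x)) q =
      - \<i> * snd v / 2 - h (fst v) (fst q) - 8 * k (fst q) (fst q) * k (fst v) (fst q)"
    unfolding del_def D
    by (simp add: complex_eq_iff cscale_def hermitian_form_simps[OF h] hermitian_form_simps[OF k] c field_simps)
  show "delbar v (\<lambda>x. complex_of_real (rho' h (\<lambda>z. 4 * (Re (k z z))\<^sup>2) x)) q =
      \<i> * cnj (snd v) / 2 - h (fst q) (fst v) - 8 * k (fst q) (fst q) * k (fst q) (fst v)"
    unfolding delbar_def D c
    by (simp add: complex_eq_iff cscale_def hermitian_form_simps[OF h] hermitian_form_simps[OF k] c field_simps)
qed

lemma levi_form_rho':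
  fixes h k :: "complex^'m \<Rightarrow> complex^'m \<Rightarrow> complex"
  assumes h: "hermitian_form h" and k: "hermitian_form k"
  shows "levi_form (rho' h (\<lambda>z. 4 * (Re (k z z))\<^sup>2)) q v u =
      - h (fst v) (fst u)
      - 8 * (k (fst v) (fst q) * k (fst q) (fst u) + k (fst q) (fst q) * k (fst v) (fst u))"
proof -
  have "((\<lambda>q. \<i> * cnj (snd u) / 2 - h (fst q) (fst u) - 8 * k (fst q) (fst q) * k (fst q) (fst u))
     has_derivative (\<lambda>v. - h (fst v) (fst u)
      - 8 * ((k (fst v) (fst q) + k (fst q) (fst v)) * k (fst q) (fst u) + k (fst q) (fst q) * k (fst v) (fst u))))
     (at q)"
    by (rule derivative_eq_intros bounded_bilinear.FDERIV[OF bounded_bilinear_hermitian_form[OF h]]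
       bounded_bilinear.FDERIV[OF bounded_bilinear_hermitian_form[OF k]] refl)+
       (auto simp: fun_eq_iff algebra_simps hermitian_form_simps[OF h] hermitian_form_simps[OF k])
  note D = frechet_derivative_at[OF this, symmetric]
  \<comment> \<open>\<open>del\<close> keeps the part of the derivative that is complex linear in
    \<open>v\<close>: the contributions \<open>a\<close>, \<open>b\<close>, \<open>e\<close>
    survive, while \<open>b'\<close>, standing for \<open>k (fst q) (fst v)\<close>, is antilinear
    and cancels.\<close>
  have "(- a - 8 * ((b + b') * c + d * e) - \<i> * (- (\<i> * a) - 8 * ((\<i> * b - \<i> * b') * c + d * (\<i> * e)))) / 2
      = - a - 8 * (b * c + d * e)" for a b b' c d e :: complex
    by (simp add: algebra_simps diff_divide_distrib add_divide_distrib)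
  then show ?thesis
    unfolding levi_form_def del_rho'(2)[OF h k] del_def D
    by (simp add: cscale_def hermitian_form_simps[OF h] hermitian_form_simps[OF k])
qed

section \<open>Polynomial functions\<close>

lemma poly_fun_le_monomial:
  assumes "sum \<alpha> UNIV + k \<le> d"
  shows "poly_fun_le d (\<lambda>Z :: (complex^'n) \<times> complex. zmonom \<alpha> (fst Z) * snd Z ^ k)"
  unfolding poly_fun_le_def
proof (intro exI[of _ "\<lambda>\<alpha>' k'. if \<alpha>' = \<alpha> \<and> k' = k then 1 else 0"] allI)
  fix z :: "complex^'n" and w :: complex
  have "(\<Sum>(\<alpha>', k') | sum \<alpha>' UNIV + k' \<le> d.
          (if \<alpha>' = \<alpha> \<and> k' = k then 1 else 0) * zmonom \<alpha>' z * w ^ k') =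
        (\<Sum>p | sum (fst p) UNIV + snd p \<le> d.
          if p = (\<alpha>, k) then zmonom \<alpha> z * w ^ k else 0)"
    by (rule sum.cong) (auto split: if_splits)
  also have "\<dots> = zmonom \<alpha> z * w ^ k"
    by (subst sum.delta) (use assms finite_poly_indices[of d] in \<open>simp_all add: case_prod_unfold\<close>)
  finally show "zmonom \<alpha> (fst (z, w)) * snd (z, w) ^ k =
      (\<Sum>(\<alpha>', k') | sum \<alpha>' UNIV + k' \<le> d.
          (if \<alpha>' = \<alpha> \<and> k' = k then 1 else 0) * zmonom \<alpha>' z * w ^ k')"
    by simp
qed

lemma poly_fun_le_add:
  assumes "poly_fun_le d f" "poly_fun_le d g"
  shows "poly_fun_le d (\<lambda>Z. f Z + g Z)"
proof -
  obtain a b where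
    "\<forall>z w. f (z, w) = (\<Sum>(\<alpha>, k) | sum \<alpha> UNIV + k \<le> d. a \<alpha> k * zmonom \<alpha> z * w ^ k)"
    "\<forall>z w. g (z, w) = (\<Sum>(\<alpha>, k) | sum \<alpha> UNIV + k \<le> d. b \<alpha> k * zmonom \<alpha> z * w ^ k)"
    using assms unfolding poly_fun_le_def by blast
  then show ?thesis
    unfolding poly_fun_le_def
    by (intro exI[of _ "\<lambda>\<alpha> k. a \<alpha> k + b \<alpha> k"])
       (simp add: case_prod_beta algebra_simps flip: sum.distrib)
qed

lemma poly_fun_le_mult_const:
  assumes "poly_fun_le d f"
  shows "poly_fun_le d (\<lambda>Z. f Z * c)"
proof -
  obtain a where
    "\<forall>z w. f (z, w) = (\<Sum>(\<alpha>, k) | sum \<alpha> UNIV + k \<le> d. a \<alpha> k * zmonom \<alpha> z * w ^ k)"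
    using assms unfolding poly_fun_le_def by blast
  then show ?thesis
    unfolding poly_fun_le_def
    by (intro exI[of _ "\<lambda>\<alpha> k. c * a \<alpha> k"])
       (simp add: case_prod_beta sum_distrib_left mult_ac)
qed

lemma poly_fun_le_sum:
  assumes "\<And>i. i \<in> I \<Longrightarrow> poly_fun_le d (f i)"
  shows "poly_fun_le d (\<lambda>Z. \<Sum>i\<in>I. f i Z)"
  using assms
proof (induction I rule: infinite_finite_induct)
  case (insert i I)
  then show ?case
    by (simp add: poly_fun_le_add)
qed (auto simp: poly_fun_le_def intro!: exI[of _ "\<lambda>_ _. 0"])

lemma zmonom_0: "zmonom (\<lambda>_. 0) z = 1"
  by (simp add: zmonom_def)

lemma zmonom_single: "zmonom (\<lambda>j. if j = i then 1 else 0) z = z $ i"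
  by (simp add: zmonom_def if_distrib cong: if_cong)

lemma zmonom_add: "zmonom (\<lambda>j. \<alpha> j + \<beta> j) z = zmonom \<alpha> z * zmonom \<beta> z"
  by (simp add: zmonom_def power_add prod.distrib)

lemma poly_fun_le_snd_power:
  assumes "k \<le> d"
  shows "poly_fun_le d (\<lambda>Z :: (complex^'n) \<times> complex. snd Z ^ k)"
  using poly_fun_le_monomial[of "\<lambda>_. 0" k d] assms by (simp add: zmonom_0)

lemma poly_fun_le_fst_times_snd_power:
  assumes "Suc k \<le> d"
  shows "poly_fun_le d (\<lambda>Z :: (complex^'n) \<times> complex. fst Z $ i * snd Z ^ k)"
  using poly_fun_le_monomial[of "\<lambda>j. if j = i then 1 else 0" k d] assms by (simp add: zmonom_single)

text \<open>The second difference in \<open>w\<close> annihilates every polynomial of degree at most one.\<close>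

lemma poly_fun_le_1_second_difference:
  fixes f :: "(complex^'n) \<times> complex \<Rightarrow> complex"
  assumes "poly_fun_le e f" "e < 2"
  shows "f (0, 1) + f (0, - 1) = 2 * f (0, 0)"
proof -
  obtain c where f: "\<And>z w. f (z, w) = (\<Sum>(\<alpha>, k) | sum \<alpha> UNIV + k \<le> e. c \<alpha> k * zmonom \<alpha> z * w ^ k)"
    using assms unfolding poly_fun_le_def by blast
  have "(\<Sum>(\<alpha>, k) | sum \<alpha> UNIV + k \<le> e. c \<alpha> k * zmonom \<alpha> (0 :: complex^'n) * (1 ^ k + (- 1) ^ k - 2 * 0 ^ k)) = 0"
  proof (rule sum.neutral, clarify)
    fix \<alpha> :: "'n \<Rightarrow> nat" and k
    assume "sum \<alpha> UNIV + k \<le> e"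
    with assms have "k = 0 \<or> k = 1"
      by linarith
    then show "c \<alpha> k * zmonom \<alpha> (0 :: complex^'n) * (1 ^ k + (- 1) ^ k - 2 * 0 ^ k) = 0"
      by auto
  qed
  then have "f (0, 1) + f (0, - 1) - 2 * f (0, 0) = 0"
    unfolding f by (simp add: case_prod_beta algebra_simps sum.distrib sum_subtractf sum_distrib_left)
  then show ?thesis
    by simp
qed

section \<open>Bihomogeneous polynomials\<close>

definition bihom :: "nat \<Rightarrow> nat \<Rightarrow> (complex^'m \<Rightarrow> complex) \<Rightarrow> bool" where
  "bihom d e f \<longleftrightarrow>
     (\<exists>c. \<forall>z. f z =
        (\<Sum>(\<alpha>, \<beta>) | sum \<alpha> UNIV = d \<and> sum \<beta> UNIV = e. c \<alpha> \<beta> * zmonom \<alpha> z * cnj (zmonom \<beta> z)))"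

lemma bihom_monomial:
  assumes "sum \<alpha> UNIV = d" "sum \<beta> UNIV = e"
  shows "bihom d e (\<lambda>z :: complex^'m. zmonom \<alpha> z * cnj (zmonom \<beta> z))"
  unfolding bihom_def
proof (intro exI[of _ "\<lambda>\<alpha>' \<beta>'. if \<alpha>' = \<alpha> \<and> \<beta>' = \<beta> then 1 else 0"] allI)
  fix z :: "complex^'m"
  have "(\<Sum>(\<alpha>', \<beta>') | sum \<alpha>' UNIV = d \<and> sum \<beta>' UNIV = e.
          (if \<alpha>' = \<alpha> \<and> \<beta>' = \<beta> then 1 else 0) * zmonom \<alpha>' z * cnj (zmonom \<beta>' z)) =
        (\<Sum>p | sum (fst p) UNIV = d \<and> sum (snd p) UNIV = e.
          if p = (\<alpha>, \<beta>) then zmonom \<alpha> z * cnj (zmonom \<beta> z) else 0)"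
    by (rule sum.cong) (auto split: if_splits)
  also have "\<dots> = zmonom \<alpha> z * cnj (zmonom \<beta> z)"
    by (subst sum.delta)
       (use assms finite_bihomogeneous_indices[of d e, unfolded case_prod_unfold] in simp_all)
  finally show "zmonom \<alpha> z * cnj (zmonom \<beta> z) =
      (\<Sum>(\<alpha>', \<beta>') | sum \<alpha>' UNIV = d \<and> sum \<beta>' UNIV = e.
          (if \<alpha>' = \<alpha> \<and> \<beta>' = \<beta> then 1 else 0) * zmonom \<alpha>' z * cnj (zmonom \<beta>' z))"
    by simp
qed

lemma bihom_add:
  assumes "bihom d e f" "bihom d e g"
  shows "bihom d e (\<lambda>z. f z + g z)"
proof -
  obtain a b where
    "\<forall>z. f z = (\<Sum>(\<alpha>, \<beta>) | sum \<alpha> UNIV = d \<and> sum \<beta> UNIV = e. a \<alpha> \<beta> * zmonom \<alpha> z * cnj (zmonom \<beta> z))"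
    "\<forall>z. g z = (\<Sum>(\<alpha>, \<beta>) | sum \<alpha> UNIV = d \<and> sum \<beta> UNIV = e. b \<alpha> \<beta> * zmonom \<alpha> z * cnj (zmonom \<beta> z))"
    using assms unfolding bihom_def by blast
  then show ?thesis
    unfolding bihom_def
    by (intro exI[of _ "\<lambda>\<alpha> \<beta>. a \<alpha> \<beta> + b \<alpha> \<beta>"])
       (simp add: case_prod_beta algebra_simps flip: sum.distrib)
qed

lemma bihom_mult_const:
  assumes "bihom d e f"
  shows "bihom d e (\<lambda>z. f z * c)"
proof -
  obtain a where
    "\<forall>z. f z = (\<Sum>(\<alpha>, \<beta>) | sum \<alpha> UNIV = d \<and> sum \<beta> UNIV = e. a \<alpha> \<beta> * zmonom \<alpha> z * cnj (zmonom \<beta> z))"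
    using assms unfolding bihom_def by blast
  then show ?thesis
    unfolding bihom_def
    by (intro exI[of _ "\<lambda>\<alpha> \<beta>. c * a \<alpha> \<beta>"])
       (simp add: case_prod_beta sum_distrib_left mult_ac)
qed

lemma bihom_sum:
  assumes "\<And>i. i \<in> I \<Longrightarrow> bihom d e (f i)"
  shows "bihom d e (\<lambda>z. \<Sum>i\<in>I. f i z)"
  using assms
proof (induction I rule: infinite_finite_induct)
  case (insert i I)
  then show ?case
    by (simp add: bihom_add)
qed (auto simp: bihom_def intro!: exI[of _ "\<lambda>_ _. 0"])

text \<open>Expanding both factors in coordinates leaves products of two coordinates and two
  conjugate coordinates, with constant coefficients.\<close>

lemma bihom_square:
  fixes k :: "complex^'m \<Rightarrow> complex^'m \<Rightarrow> complex"
  assumes k: "hermitian_form k"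
  shows "bihom 2 2 (\<lambda>z. (k z z)\<^sup>2)"
proof -
  have mon: "bihom 2 2 (\<lambda>z :: complex^'m. (z $ i * z $ i') * (cnj (z $ j) * cnj (z $ j')))" for i j i' j'
  proof -
    \<comment> \<open>\<open>?e i\<close> is the exponent vector of the coordinate
      \<open>z $ i\<close>; the sum of two of them has degree 2 also when the indices
      coincide.\<close>
    let ?e = "\<lambda>i j :: 'm. if j = i then 1 else 0 :: nat"
    have "bihom 2 2 (\<lambda>z :: complex^'m. zmonom (\<lambda>l. ?e i l + ?e i' l) z * cnj (zmonom (\<lambda>l. ?e j l + ?e j' l) z))"
      by (rule bihom_monomial) (simp_all add: sum.distrib)
    then show ?thesis
      by (simp only: zmonom_add zmonom_single complex_cnj_mult)
  qed
  have "(k z z)\<^sup>2 = (\<Sum>i\<in>UNIV. \<Sum>i'\<in>UNIV. \<Sum>j\<in>UNIV. \<Sum>j'\<in>UNIV.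
      (z $ i * z $ i') * (cnj (z $ j) * cnj (z $ j')) * (k (axis i 1) (axis j' 1) * k (axis i' 1) (axis j 1)))"
    for z
    unfolding power2_eq_square hermitian_form_expand[OF k, of z z]
    by (simp add: sum_distrib_left sum_distrib_right mult_ac)
  then show ?thesis
    by (auto intro!: bihom_sum bihom_mult_const mon)
qed

text \<open>Since \<open>k z z\<close> is real, its complex square is the square of its real part,
  and the expansion found for \<open>bihom\<close> carries over.\<close>

lemma real_bihomogeneous_square:
  assumes "hermitian_form k"
  shows "real_bihomogeneous 2 2 (\<lambda>z. 4 * (Re (k z z))\<^sup>2)"
proof -
  have "complex_of_real (4 * (Re (k z z))\<^sup>2) = (k z z)\<^sup>2 * 4" for z
    by (subst hermitian_form_diag[OF assms, of z]) simp
  with bihom_mult_const[OF bihom_square[OF assms], of 4] show ?thesis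
    unfolding bihom_def real_bihomogeneous_def by presburger
qed

section \<open>The map and the target in adapted coordinates\<close>

text \<open>Chain rule along a curve in \<open>M\<close>: the composite
  \<open>r (\<gamma> t)\<close> is constantly zero, so its derivative \<open>D a\<close> at 0
  vanishes.\<close>

lemma derivative_tangent_space:
  fixes r :: "'a::real_normed_vector \<Rightarrow> real"
  assumes a: "a \<in> tangent_space M q" and D: "(r has_derivative D) (at q)"
    and zero: "\<And>x. x \<in> M \<Longrightarrow> r x = 0"
  shows "D a = 0"
proof -
  from a obtain \<gamma> :: "real \<Rightarrow> 'a" where \<gamma>: "\<gamma> 0 = q" "range \<gamma> \<subseteq> M" "(\<gamma> has_vector_derivative a) (at 0)"
    unfolding tangent_space_def by blast
  have "((\<lambda>t. r (\<gamma> t)) has_derivative (\<lambda>t. D (t *\<^sub>R a))) (at 0)"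
    using \<gamma>(3) D unfolding has_vector_derivative_def \<gamma>(1)[symmetric]
    by (rule has_derivative_compose)
  moreover have "r (\<gamma> t) = 0" for t
    using \<gamma>(2) by (intro zero) blast
  ultimately have "((\<lambda>t :: real. 0 :: real) has_derivative (\<lambda>t. D (t *\<^sub>R a))) (at 0)"
    by simp
  then have "(\<lambda>t. D (t *\<^sub>R a)) = (\<lambda>t. 0)"
    by (rule has_derivative_unique) (rule has_derivative_const)
  from fun_cong[OF this, of 1] show ?thesis
    by simp
qed

text \<open>Linear coordinates \<open>X\<close>, \<open>Y\<close>, \<open>R\<close> with inverse
  \<open>E\<close> split the target space into two copies of the source \<open>z\<close>-space and a
  line, and put \<open>h'\<close> into a normal form built from the source form \<open>g\<close>.
  Both statements of the theorem are instances: in the first \<open>h'\<close> may be chosen, in the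
  second it is prescribed.\<close>

locale adapted_coordinates =
  fixes g :: "complex^'n \<Rightarrow> complex^'n \<Rightarrow> complex"
    and h' :: "complex^'m \<Rightarrow> complex^'m \<Rightarrow> complex"
    and X Y :: "complex^'m \<Rightarrow> complex^'n" and R :: "complex^'m \<Rightarrow> complex"
    and E :: "complex^'n \<Rightarrow> complex^'n \<Rightarrow> complex \<Rightarrow> complex^'m"
  assumes g: "hermitian_form g" "nondegenerate_form g"
    and h': "h' u v = 4 * \<i> * (g (Y u) (X v) - g (X u) (Y v)) + 2 * R u * cnj (R v)"
    and add: "X (u + v) = X u + X v" "Y (u + v) = Y u + Y v" "R (u + v) = R u + R v"
    and scale: "X (c *s u) = c *s X u" "Y (c *s u) = c *s Y u" "R (c *s u) = c * R u"
    and coords_E: "X (E x y r) = x" "Y (E x y r) = y" "R (E x y r) = r"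
    and E_coords: "E (X u) (Y u) (R u) = u"
begin

text \<open>The inverse of a linear bijection is linear: both sides have the same \<open>X\<close>,
  \<open>Y\<close>, \<open>R\<close>, and by \<open>E_coords\<close> these determine a
  vector.\<close>

lemma E_add: "E (x + x') (y + y') (r + r') = E x y r + E x' y' r'"
  using E_coords[of "E x y r + E x' y' r'"] by (simp add: add coords_E)

lemma E_scale: "E (c *s x) (c *s y) (c * r) = c *s E x y r"
  using E_coords[of "c *s E x y r"] by (simp add: scale coords_E)

lemma hermitian_h': "hermitian_form h'"
  unfolding hermitian_form_def h'
proof (intro conjI allI)
  fix x u
  show "4 * \<i> * (g (Y u) (X x) - g (X u) (Y x)) + 2 * R u * cnj (R x) =
      cnj (4 * \<i> * (g (Y x) (X u) - g (X x) (Y u)) + 2 * R x * cnj (R u))"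
    by (simp add: algebra_simps flip: hermitian_form_cnj[OF g(1)])
qed (simp_all add: add scale hermitian_form_simps[OF g(1)] algebra_simps)

text \<open>Since \<open>X\<close> reads off \<open>z\<close> from the first component of
  \<open>H (z, w)\<close>, this form takes the value \<open>g z z\<close> there, whose square is the
  quartic term to be matched.\<close>

definition k :: "complex^'m \<Rightarrow> complex^'m \<Rightarrow> complex" where
  "k u v = g (X u) (X v)"

lemma hermitian_k: "hermitian_form k"
  unfolding hermitian_form_def k_def
proof (intro conjI allI)
  fix x u
  show "g (X u) (X x) = cnj (g (X x) (X u))"
    by (rule hermitian_form_cnj[OF g(1)])
qed (simp_all add: add scale hermitian_form_simps[OF g(1)])

abbreviation \<phi> :: "complex^'m \<Rightarrow> real" where
  "\<phi> \<equiv> \<lambda>z. 4 * (Re (k z z))\<^sup>2"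

abbreviation target :: "((complex^'m) \<times> complex) set" where
  "target \<equiv> {Z. rho' h' \<phi> Z = 0}"

text \<open>The coordinates \<open>z\<close> and \<open>w z\<close> produce the products of
  \<open>g z z\<close> with \<open>w\<close> and its conjugate, and the coordinate \<open>w\<close>
  produces \<open>|w|^2\<close>. The last component adds
  \<open>Im (2 * \<i> * w^2) = 2 * Re (w^2)\<close>.\<close>

definition H :: "(complex^'n) \<times> complex \<Rightarrow> (complex^'m) \<times> complex" where
  "H Z = (E (fst Z) (snd Z *s fst Z) (snd Z), 2 * \<i> * (snd Z)\<^sup>2)"

lemma rho'_H: "rho' h' \<phi> (H (z, w)) = - 4 * (Im w - Re (g z z))\<^sup>2"
proof -
  \<comment> \<open>A real name for \<open>g z z\<close> reduces the claim to a polynomial identity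
    in \<open>a\<close>, \<open>Re w\<close> and \<open>Im w\<close>.\<close>
  obtain a where a: "g z z = complex_of_real a"
    using hermitian_form_diag[OF g(1)] by blast
  show ?thesis
    by (simp add: rho'_def H_def h' k_def coords_E hermitian_form_simps[OF g(1)] a)
       (simp add: power2_eq_square algebra_simps)
qed

text \<open>The order of the test vectors decouples the equations. The quartic part sees only
  \<open>X u\<close>, so vectors with \<open>X u = 0\<close> yield \<open>X a = 0\<close> and
  \<open>R a = 0\<close>. After that the quartic part is zero, as each of its terms contains
  \<open>X a\<close>, and the remaining pairing forces \<open>Y a = 0\<close>.\<close>

lemma levi_kernel_trivial:
  assumes "\<And>u. h' a u + 8 * (k a z * k z u + k z z * k a u) = 0"
  shows "a = 0"
proof -
  have *: "4 * \<i> * (g (Y a) x - g (X a) y) + 2 * R a * cnj r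
      + 8 * (k a z * g (X z) x + k z z * g (X a) x) = 0" for x y r
    using assms[of "E x y r"] by (simp add: h' k_def coords_E)
  have "g (X a) y = 0" for y
    using *[of 0 y 0] by (simp add: hermitian_form_simps[OF g(1)])
  then have X: "X a = 0"
    using g(2) unfolding nondegenerate_form_def by blast
  have R: "R a = 0"
    using *[of 0 0 1] by (simp add: hermitian_form_simps[OF g(1)])
  have "g (Y a) x = 0" for x
    using *[of x 0 0] by (simp add: hermitian_form_simps[OF g(1)] X k_def)
  then have Y: "Y a = 0"
    using g(2) unfolding nondegenerate_form_def by blast
  have "E 0 0 0 = 0"
    using E_scale[of 0 0 0 0] by simp
  with E_coords[of a] X Y R show ?thesis
    by simp
qed

lemma levi_nondegenerate_target: "levi_nondegenerate target"
proof -
  have local: "local_defining target q UNIV (rho' h' \<phi>)" if "q \<in> target" for q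
  proof -
    \<comment> \<open>The direction \<open>(0, \<i>)\<close> shows that the differential vanishes
      nowhere, so \<open>rho'\<close> is a global defining function.\<close>
    have vertical: "frechet_derivative (rho' h' \<phi>) (at x) (0, \<i>) = 1" for x
      unfolding frechet_derivative_at[OF has_derivative_rho'[OF hermitian_h' hermitian_k], symmetric]
      by (simp add: hermitian_form_simps[OF hermitian_h'] hermitian_form_simps[OF hermitian_k])
    have "\<exists>v. frechet_derivative (rho' h' \<phi>) (at x) v \<noteq> 0" for x
      by (rule exI[of _ "(0, \<i>)"]) (simp only: vertical one_neq_zero not_False_eq_True)
    then show "local_defining target q UNIV (rho' h' \<phi>)"
      unfolding local_defining_def
      using smooth_on_real_polynomial_function[OF real_polynomial_function_rho'[OF hermitian_h' hermitian_k]]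
      by simp
  qed
  have "\<not> levi_eigenvalue (rho' h' \<phi>) q 0" for q
  proof
    assume "levi_eigenvalue (rho' h' \<phi>) q 0"
    then obtain v where v: "v \<in> holo_tangent (rho' h' \<phi>) q" "v \<noteq> 0"
      "\<And>u. u \<in> holo_tangent (rho' h' \<phi>) q \<Longrightarrow> levi_form (rho' h' \<phi>) q v u = 0"
      unfolding levi_eigenvalue_def by auto
    have tangent: "u \<in> holo_tangent (rho' h' \<phi>) q \<longleftrightarrow>
        - \<i> * snd u / 2 - h' (fst u) (fst q) - 8 * k (fst q) (fst q) * k (fst u) (fst q) = 0" for u
      unfolding holo_tangent_def del_rho'(1)[OF hermitian_h' hermitian_k] by simp
    have "h' (fst v) a + 8 * (k (fst v) (fst q) * k (fst q) a + k (fst q) (fst q) * k (fst v) a) = 0" for a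
    proof -
      \<comment> \<open>The second component solves the tangency equation for the given
        \<open>a\<close>. The holomorphic tangent space is thus a graph over the first component,
        and every \<open>a\<close> is available as a test vector.\<close>
      have "(a, 2 * \<i> * (h' a (fst q) + 8 * k (fst q) (fst q) * k a (fst q))) \<in> holo_tangent (rho' h' \<phi>) q"
        unfolding tangent by simp
      from v(3)[OF this] show ?thesis
        unfolding levi_form_rho'[OF hermitian_h' hermitian_k] fst_conv by algebra
    qed
    then have "fst v = 0"
      by (rule levi_kernel_trivial)
    \<comment> \<open>With vanishing first component the tangency equation retains only the term in
      \<open>snd v\<close>.\<close>
    moreover from this v(1) have "snd v = 0"
      by (simp add: tangent hermitian_form_simps[OF hermitian_h'] hermitian_form_simps[OF hermitian_k])
    ultimately show False
      using v(2) by (simp add: prod_eq_iff)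
  qed
  with local show ?thesis
    unfolding levi_nondegenerate_def real_hypersurface_def by blast
qed

section \<open>Derivative of \<open>H\<close> and the embedding property\<close>

lemma bounded_linear_coords: "bounded_linear X" "bounded_linear Y" "bounded_linear R"
  unfolding linear_conv_bounded_linear[symmetric]
  by (auto intro!: linearI simp: add scale scaleR_eq_scalar_mult scaleR_conv_of_real)

lemma bounded_linear_E: "bounded_linear (\<lambda>p. E (fst p) (fst (snd p)) (snd (snd p)))"
  unfolding linear_conv_bounded_linear[symmetric]
  by (auto intro!: linearI simp: E_add scaleR_eq_scalar_mult simp flip: E_scale)
     (simp add: scaleR_conv_of_real)

lemma bounded_bilinear_scalar_mult: "bounded_bilinear ((*s) :: complex \<Rightarrow> complex^'n \<Rightarrow> complex^'n)"
  unfolding bilinear_conv_bounded_bilinear[symmetric] bilinear_def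
  by (auto intro!: linearI simp: scaleR_eq_scalar_mult vec_eq_iff scaleR_conv_of_real algebra_simps)

lemma has_derivative_H:
  "(H has_derivative (\<lambda>v. (E (fst v) (snd p *s fst v + snd v *s fst p) (snd v), 4 * \<i> * snd p * snd v))) (at p)"
proof -
  have smult: "((\<lambda>Z. snd Z *s fst Z) has_derivative (\<lambda>v. snd p *s fst v + snd v *s fst p)) (at p)"
    by (rule bounded_bilinear.FDERIV[OF bounded_bilinear_scalar_mult]) (rule derivative_intros)+
  have "((\<lambda>Z. E (fst Z) (snd Z *s fst Z) (snd Z)) has_derivative
      (\<lambda>v. E (fst v) (snd p *s fst v + snd v *s fst p) (snd v))) (at p)"
    using bounded_linear.has_derivative[OF bounded_linear_E
        has_derivative_Pair[OF has_derivative_fst[OF has_derivative_ident]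
          has_derivative_Pair[OF smult has_derivative_snd[OF has_derivative_ident]]]]
    by simp
  moreover have "((\<lambda>Z :: (complex^'n) \<times> complex. 2 * \<i> * (snd Z)\<^sup>2) has_derivative (\<lambda>v. 4 * \<i> * snd p * snd v)) (at p)"
    by (auto intro!: derivative_eq_intros)
  ultimately show ?thesis
    unfolding H_def by (rule has_derivative_Pair)
qed

text \<open>\<open>X\<close> and \<open>R\<close> recover \<open>z\<close> and \<open>w\<close> from
  the first component of \<open>H\<close>, which gives a continuous left inverse. The same two
  coordinates recover \<open>v\<close> from the derivative of \<open>H\<close> applied to
  \<open>v\<close>, which gives injectivity.\<close>

lemma embedding_H: "embedding H"
  unfolding embedding_def
proof (intro conjI allI)
  fix p
  show "H differentiable (at p)"
    using has_derivative_H differentiableI by blast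
  show "inj (frechet_derivative H (at p))"
    unfolding frechet_derivative_at[OF has_derivative_H, symmetric]
  proof (rule injI)
    fix u v
    assume "(E (fst u) (snd p *s fst u + snd u *s fst p) (snd u), 4 * \<i> * snd p * snd u) =
       (E (fst v) (snd p *s fst v + snd v *s fst p) (snd v), 4 * \<i> * snd p * snd v)"
    then show "u = v"
      by (metis coords_E(1,3) fst_conv prod_eqI)
  qed
next
  show "\<exists>G. homeomorphism UNIV (range H) H G"
  proof (intro exI homeomorphismI)
    show "continuous_on UNIV H"
      by (rule has_derivative_continuous_on, rule has_derivative_at_withinI, rule has_derivative_H)
    show "continuous_on (range H) (\<lambda>q. (X (fst q), R (fst q)))"
      by (intro continuous_intros bounded_linear.continuous_on[OF bounded_linear_coords(1)]
          bounded_linear.continuous_on[OF bounded_linear_coords(3)])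
  qed (auto simp: H_def coords_E)
qed

section \<open>Degree of \<open>H\<close>\<close>

lemma E_expand:
  "E x y r $ i = (\<Sum>j\<in>UNIV. x $ j * E (axis j 1) 0 0 $ i) + (\<Sum>j\<in>UNIV. y $ j * E 0 (axis j 1) 0 $ i)
     + r * E 0 0 1 $ i"
proof -
  have zero: "E 0 0 0 = 0"
    using E_scale[of 0 0 0 0] by simp
  have "E (\<Sum>j\<in>J. x $ j *s axis j 1) 0 0 = (\<Sum>j\<in>J. x $ j *s E (axis j 1) 0 0)" for J
  proof (induction J rule: infinite_finite_induct)
    case (insert j J)
    then show ?case
      using E_add[of "x $ j *s axis j 1" _ 0 0 0 0] E_scale[of "x $ j" "axis j 1" 0 0] by simp
  qed (simp_all add: zero)
  then have x: "E x 0 0 $ i = (\<Sum>j\<in>UNIV. x $ j * E (axis j 1) 0 0 $ i)"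
    by (subst (1) vec_eq_sum_axis[of x]) simp
  have "E 0 (\<Sum>j\<in>J. y $ j *s axis j 1) 0 = (\<Sum>j\<in>J. y $ j *s E 0 (axis j 1) 0)" for J
  proof (induction J rule: infinite_finite_induct)
    case (insert j J)
    then show ?case
      using E_add[of 0 0 "y $ j *s axis j 1" _ 0 0] E_scale[of "y $ j" 0 "axis j 1" 0] by simp
  qed (simp_all add: zero)
  then have y: "E 0 y 0 $ i = (\<Sum>j\<in>UNIV. y $ j * E 0 (axis j 1) 0 $ i)"
    by (subst (1) vec_eq_sum_axis[of y]) simp
  have "E x y r = E x 0 0 + E 0 y 0 + r *s E 0 0 1"
    using E_add[of x 0 0 y 0 0] E_add[of x 0 y 0 0 r] E_scale[of r 0 0 1] by simp
  then show ?thesis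
    by (simp add: x y)
qed

lemma poly_map_of_degree_H: "poly_map_of_degree 2 H"
  unfolding poly_map_of_degree_def
proof (intro conjI allI impI)
  have lin: "poly_fun_le 2 (\<lambda>Z :: (complex^'n) \<times> complex. fst Z $ j)"
    and quad: "poly_fun_le 2 (\<lambda>Z :: (complex^'n) \<times> complex. (snd Z *s fst Z) $ j)"
    and w: "poly_fun_le 2 (\<lambda>Z :: (complex^'n) \<times> complex. snd Z)"
    and w2: "poly_fun_le 2 (\<lambda>Z :: (complex^'n) \<times> complex. (snd Z)\<^sup>2)" for j
    using poly_fun_le_fst_times_snd_power[of 0 2 j] poly_fun_le_fst_times_snd_power[of 1 2 j]
      poly_fun_le_snd_power[of 1 2] poly_fun_le_snd_power[of 2 2]
    by (simp_all add: mult.commute)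
  have "(\<lambda>Z. fst (H Z) $ i) = (\<lambda>Z. (\<Sum>j\<in>UNIV. fst Z $ j * E (axis j 1) 0 0 $ i)
      + (\<Sum>j\<in>UNIV. (snd Z *s fst Z) $ j * E 0 (axis j 1) 0 $ i) + snd Z * E 0 0 1 $ i)" for i
    unfolding H_def fst_conv by (rule ext, rule E_expand)
  then have "poly_fun_le 2 (\<lambda>Z. fst (H Z) $ i)" for i
    by (simp only:) (intro poly_fun_le_add poly_fun_le_sum poly_fun_le_mult_const lin quad w)
  moreover have "poly_fun_le 2 (\<lambda>Z. snd (H Z))"
    using poly_fun_le_mult_const[OF w2, of "2 * \<i>"] by (simp add: H_def mult.commute)
  ultimately show "poly_map_le 2 H"
    by (simp add: poly_map_le_def)
next
  fix e :: nat
  assume "e < 2"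
  show "\<not> poly_map_le e H"
  proof
    assume "poly_map_le e H"
    then have "poly_fun_le e (\<lambda>Z. snd (H Z))"
      by (simp add: poly_map_le_def)
    \<comment> \<open>Degree 2 is attained in the last component: the values of
      \<open>2 * \<i> * w^2\<close> at 1 and -1 add up to \<open>4 * \<i>\<close>, while its value
      at 0 is 0.\<close>
    from poly_fun_le_1_second_difference[OF this \<open>e < 2\<close>] show False
      by (simp add: H_def)
  qed
qed

section \<open>Image of the hyperquadric and failure of both alternatives\<close>

lemma H_hyperquadric: "H ` hyperquadric g \<subseteq> target"
  by (auto simp: hyperquadric_def rho'_H)

lemma no_neighbourhood_into_target:
  "\<not> (\<exists>V. open V \<and> hyperquadric g \<subseteq> V \<and> H ` V \<subseteq> target)"
proof
  assume "\<exists>V. open V \<and> hyperquadric g \<subseteq> V \<and> H ` V \<subseteq> target"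
  then obtain V where V: "open V" "hyperquadric g \<subseteq> V" "H ` V \<subseteq> target"
    by blast
  have "(0, 0) \<in> V"
    using V(2) by (auto simp: hyperquadric_def hermitian_form_simps[OF g(1)])
  with V(1) obtain e where e: "e > 0" "ball (0, 0) e \<subseteq> V"
    using open_contains_ball by blast
  \<comment> \<open>A point near the origin but off the hyperquadric: here
    \<open>Im w - Re (g 0 0) = e / 2\<close>, so \<open>rho'\<close> has the value
    \<open>- (e^2)\<close> at its image.\<close>
  have "(0, \<i> * complex_of_real (e / 2)) \<in> ball ((0, 0) :: (complex^'n) \<times> complex) e"
    using e(1) by (simp add: dist_Pair_Pair norm_mult)
  with e(2) V(3) have "rho' h' \<phi> (H (0, \<i> * complex_of_real (e / 2))) = 0"
    by blast
  with e(1) show False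
    by (simp add: rho'_H hermitian_form_simps[OF g(1)])
qed

text \<open>\<open>\<rho>' \<circ> H\<close> is a multiple of \<open>\<rho>\<^sup>2\<close>, so \<open>d\<rho>' \<circ> dH\<close> vanishes along \<open>M\<close>.\<close>

lemma not_transversal:
  assumes "p \<in> hyperquadric g"
  shows "\<not> transversal_at H target p"
proof
  let ?D = "frechet_derivative (rho' h' \<phi>) (at (H p))"
  let ?r = "\<lambda>Z. Im (snd Z) - Re (g (fst Z) (fst Z))"
  have D: "(rho' h' \<phi> has_derivative ?D) (at (H p))"
    by (intro iffD1[OF frechet_derivative_works] differentiableI[OF has_derivative_rho'[OF hermitian_h' hermitian_k]])
  have lin: "linear ?D"
    using D has_derivative_linear by blast
  have vertical: "?D (0, \<i>) = 1"
    unfolding frechet_derivative_at[OF has_derivative_rho'[OF hermitian_h' hermitian_k], symmetric]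
    by (simp add: hermitian_form_simps[OF hermitian_h'] hermitian_form_simps[OF hermitian_k])
  have tangent: "?D a = 0" if "a \<in> tangent_space target (H p)" for a
    using that D by (rule derivative_tangent_space) simp
  have square: "((\<lambda>Z. - 4 * (f Z)\<^sup>2) has_derivative (\<lambda>v. 0)) (at p)"
    if "(f has_derivative f') (at p)" "f p = 0" for f f' :: "(complex^'n) \<times> complex \<Rightarrow> real"
    using that by (auto intro!: derivative_eq_intros)
  have image: "?D b = 0" if "b \<in> range (frechet_derivative H (at p))" for b
  proof -
    have r': "(?r has_derivative (\<lambda>v. Im (snd v) - Re (g (fst p) (fst v) + g (fst v) (fst p)))) (at p)"
      by (rule derivative_eq_intros bounded_bilinear.FDERIV[OF bounded_bilinear_hermitian_form[OF g(1)]] refl)+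
    have "?r p = 0"
      using assms by (auto simp: hyperquadric_def)
    with r' have "((\<lambda>Z. - 4 * (?r Z)\<^sup>2) has_derivative (\<lambda>v. 0)) (at p)"
      by (rule square)
    moreover have "(\<lambda>Z. rho' h' \<phi> (H Z)) = (\<lambda>Z. - 4 * (?r Z)\<^sup>2)"
      by (simp add: rho'_H fun_eq_iff)
    moreover have "((\<lambda>Z. rho' h' \<phi> (H Z)) has_derivative (\<lambda>v. ?D (frechet_derivative H (at p) v))) (at p)"
      using iffD1[OF frechet_derivative_works differentiableI[OF has_derivative_H]] D
      by (rule has_derivative_compose)
    ultimately have "(\<lambda>v. ?D (frechet_derivative H (at p) v)) = (\<lambda>v. 0)"
      by (simp only:) (rule has_derivative_unique)
    with that show ?thesis
      by (auto dest: fun_cong)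
  qed
  assume "transversal_at H target p"
  \<comment> \<open>The vertical vector gives the contradiction: \<open>?D\<close> is 1 on it, but 0
    on the tangent space and on the image of the derivative of \<open>H\<close>, hence on their
    sum.\<close>
  then have "(0, \<i>) \<in> {a + b | a b. a \<in> tangent_space target (H p) \<and> b \<in> range (frechet_derivative H (at p))}"
    unfolding transversal_at_def by (simp only: UNIV_I)
  then obtain a b where a: "a \<in> tangent_space target (H p)"
    and b: "b \<in> range (frechet_derivative H (at p))" and ab: "(0, \<i>) = a + b"
    by blast
  have "?D (a + b) = 0"
    unfolding linear_add[OF lin] tangent[OF a] image[OF b] by simp
  with vertical show False
    unfolding ab by simp
qed

text \<open>A proper subset \<open>A\<close> misses some point of the hyperquadric, and
  transversality fails at that point.\<close>

lemma not_generically_transversal: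
  "\<not> (\<exists>A. real_analytic_subset A (hyperquadric g) \<and> A \<noteq> hyperquadric g \<and>
        (\<forall>p \<in> hyperquadric g - A. transversal_at H target p))"
  using not_transversal unfolding real_analytic_subset_def by blast

end

section \<open>Eigenbases of a hermitian form\<close>

lemma form_matrix_mult:
  assumes "hermitian_form h"
  shows "h v u = (\<Sum>i\<in>UNIV. (form_matrix h *v v) $ i * cnj (u $ i))"
proof -
  have "(\<Sum>i\<in>UNIV. (form_matrix h *v v) $ i * cnj (u $ i)) =
      (\<Sum>i\<in>UNIV. \<Sum>j\<in>UNIV. v $ j * (cnj (u $ i) * h (axis j 1) (axis i 1)))"
    by (simp add: matrix_vector_mult_def form_matrix_def sum_distrib_right sum_distrib_left mult_ac)
  also have "\<dots> = h v u"
    unfolding hermitian_form_expand[OF assms, of v u] by (rule sum.swap)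
  finally show ?thesis
    by simp
qed

lemma eigenspace_form:
  assumes "hermitian_form h" "v \<in> eigenspace (form_matrix h) \<mu>"
  shows "h v u = complex_of_real \<mu> * (\<Sum>i\<in>UNIV. v $ i * cnj (u $ i))"
  using assms(2) unfolding form_matrix_mult[OF assms(1), of v u] eigenspace_def
  by (simp add: sum_distrib_left mult.assoc)

text \<open>The real eigenvalues can be taken out through either argument, so \<open>h v u\<close>
  is both \<open>\<mu>\<close> times and \<open>\<nu>\<close> times the standard product of
  \<open>v\<close> and \<open>u\<close>. That product is therefore zero.\<close>

lemma eigenspaces_orthogonal:
  assumes h: "hermitian_form h" and "v \<in> eigenspace (form_matrix h) \<mu>" "u \<in> eigenspace (form_matrix h) \<nu>"
    and "\<mu> \<noteq> \<nu>"
  shows "h v u = 0"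
proof -
  let ?s = "\<Sum>i\<in>UNIV. v $ i * cnj (u $ i)"
  have "h v u = complex_of_real \<mu> * ?s"
    by (rule eigenspace_form[OF h assms(2)])
  moreover have "h v u = complex_of_real \<nu> * ?s"
    unfolding hermitian_form_cnj[OF h, of v u] eigenspace_form[OF h assms(3)]
    by (simp add: mult.commute)
  ultimately show ?thesis
    using \<open>\<mu> \<noteq> \<nu>\<close> by simp
qed

text \<open>On an eigenspace \<open>h\<close> is \<open>\<mu>\<close> times the standard product.
  After multiplication by \<open>sgn \<mu>\<close> it is positive definite there, as
  orthonormalisation demands.\<close>

lemma eigenspace_form_sgn:
  assumes h: "hermitian_form h" and v: "v \<in> eigenspace (form_matrix h) \<mu>" "v \<noteq> 0" and "\<mu> \<noteq> 0"
  shows "0 < sgn \<mu> * Re (h v v)"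
proof -
  have "(\<Sum>i\<in>UNIV. v $ i * cnj (v $ i)) = complex_of_real (\<Sum>i\<in>UNIV. (cmod (v $ i))\<^sup>2)"
    by (simp add: complex_norm_square del: of_real_power)
  then have "sgn \<mu> * Re (h v v) = \<bar>\<mu>\<bar> * (\<Sum>i\<in>UNIV. (cmod (v $ i))\<^sup>2)"
    unfolding eigenspace_form[OF h v(1)] by (simp add: sgn_mult_abs abs_sgn)
  moreover obtain i where "v $ i \<noteq> 0"
    using v(2) by (auto simp: vec_eq_iff)
  then have "0 < (\<Sum>i\<in>UNIV. (cmod (v $ i))\<^sup>2)"
    by (intro sum_pos2[of _ i]) auto
  ultimately show ?thesis
    using \<open>\<mu> \<noteq> 0\<close> by simp
qed

lemma subspace_eigenspace: "vec.subspace (eigenspace A \<mu>)"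
  unfolding vec.subspace_def eigenspace_def
  by (auto simp: vec.linear_0 matrix_vector_right_distrib vec.scale_right_distrib matrix_vector_mult_scaleR
      vector_scalar_commute mult.commute)

text \<open>Gram-Schmidt, one vector at a time: fewer vectors than the dimension of \<open>S\<close>
  cannot span \<open>S\<close>, so a next one is available.\<close>

lemma orthonormal_set_exists:
  assumes g: "hermitian_form g" and S: "vec.subspace S"
    and pos: "\<And>v. v \<in> S \<Longrightarrow> v \<noteq> 0 \<Longrightarrow> 0 < Re (g v v)"
    and "k \<le> vec.dim S"
  shows "\<exists>B\<subseteq>S. finite B \<and> card B = k \<and> (\<forall>u\<in>B. \<forall>v\<in>B. g u v = (if u = v then 1 else 0))"
  using \<open>k \<le> vec.dim S\<close>
proof (induction k)
  case 0
  then show ?case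
    by (intro exI[of _ "{}"]) simp
next
  case (Suc k)
  then obtain B where B: "B \<subseteq> S" "finite B" "card B = k"
    "\<And>u v. u \<in> B \<Longrightarrow> v \<in> B \<Longrightarrow> g u v = (if u = v then 1 else 0)"
    by auto
  have "\<not> S \<subseteq> vec.span B"
    using vec.dim_le_card[of S B] B Suc.prems by auto
  then obtain v where v: "v \<in> S" "v \<notin> vec.span B"
    by blast
  \<comment> \<open>Removes from \<open>v\<close> its components along \<open>B\<close>; since
    \<open>g\<close> is linear in its first argument, the coefficients are
    \<open>g v b\<close>.\<close>
  define w where "w = v - (\<Sum>b\<in>B. g v b *s b)"
  have w: "w \<in> S" "w \<noteq> 0"
  proof -
    show "w \<in> S"
      unfolding w_def using B(1) v(1)
      by (intro vec.subspace_diff[OF S] vec.subspace_sum[OF S] vec.subspace_scale[OF S]) auto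
    have "(\<Sum>b\<in>B. g v b *s b) \<in> vec.span B"
      by (intro vec.span_sum vec.span_scale vec.span_base)
    with v(2) show "w \<noteq> 0"
      unfolding w_def by auto
  qed
  have orth: "g w b = 0" if "b \<in> B" for b
  proof -
    have "(\<Sum>c\<in>B. g v c * g c b) = (\<Sum>c\<in>B. if c = b then g v c else 0)"
      using that by (intro sum.cong) (auto simp: B(4))
    then show ?thesis
      using that B(2) by (simp add: w_def hermitian_form_simps[OF g] hermitian_form_sum[OF g])
  qed
  define r where "r = complex_of_real (1 / sqrt (Re (g w w)))"
  have r: "r * cnj r * g w w = 1"
  proof -
    have "r * cnj r * complex_of_real (Re (g w w)) = 1"
      using pos[OF w] unfolding r_def by (simp flip: of_real_mult)
    then show ?thesis
      unfolding hermitian_form_diag[OF g, of w, symmetric] .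
  qed
  have unit: "g (r *s w) (r *s w) = 1"
    using r by (simp add: hermitian_form_simps[OF g] mult_ac)
  have zero: "g (r *s w) b = 0" "g b (r *s w) = 0" if "b \<in> B" for b
    using orth[OF that] hermitian_form_cnj[OF g, of b w] by (simp_all add: hermitian_form_simps[OF g])
  have "r *s w \<notin> B"
    using unit zero(1) by fastforce
  moreover have "r *s w \<in> S"
    by (rule vec.subspace_scale[OF S w(1)])
  ultimately show ?case
    using B unit zero by (intro exI[of _ "insert (r *s w) B"]) auto
qed

text \<open>Orthonormalisation takes place inside each eigenspace for the form \<open>s * h\<close>,
  and the results are united. Orthogonality of different eigenspaces keeps the relations valid on
  the union and makes its pieces disjoint, so its size is the sum of the dimensions.\<close>

lemma eigenvalue_count_basis:
  assumes h: "hermitian_form h" and s: "\<And>\<mu>. \<mu> \<in> S \<Longrightarrow> sgn \<mu> = s" "s \<noteq> 0"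
    and "eigenvalue_count h S \<noteq> 0"
  obtains B where "finite B" "card B = eigenvalue_count h S"
    "B \<subseteq> (\<Union>\<mu>\<in>S. eigenspace (form_matrix h) \<mu>)"
    "\<And>u v. u \<in> B \<Longrightarrow> v \<in> B \<Longrightarrow> h u v = (if u = v then complex_of_real s else 0)"
proof -
  define I where "I = {\<mu>. \<mu> \<in> S \<and> eigenspace (form_matrix h) \<mu> \<noteq> {0}}"
  have count: "eigenvalue_count h S = (\<Sum>\<mu>\<in>I. vec.dim (eigenspace (form_matrix h) \<mu>))"
    unfolding eigenvalue_count_def I_def ..
  \<comment> \<open>A sum over an infinite set is 0 by convention, so a nonzero count makes the set
    of eigenvalues finite.\<close>
  have fin: "finite I"
    using assms(4) unfolding count by (metis sum.infinite)
  have "\<forall>\<mu>\<in>I. \<exists>B\<subseteq>eigenspace (form_matrix h) \<mu>. finite B \<and> card B = vec.dim (eigenspace (form_matrix h) \<mu>)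
      \<and> (\<forall>u\<in>B. \<forall>v\<in>B. complex_of_real s * h u v = (if u = v then 1 else 0))"
  proof
    fix \<mu>
    assume "\<mu> \<in> I"
    then have \<mu>: "sgn \<mu> = s" "\<mu> \<noteq> 0"
      using s unfolding I_def by force+
    have "hermitian_form (\<lambda>u v. complex_of_real s * h u v)"
      unfolding hermitian_form_def
    proof (intro conjI allI)
      fix x u
      show "complex_of_real s * h u x = cnj (complex_of_real s * h x u)"
        using hermitian_form_cnj[OF h, of u x] by simp
    qed (simp_all add: hermitian_form_simps[OF h] algebra_simps)
    then show "\<exists>B\<subseteq>eigenspace (form_matrix h) \<mu>. finite B \<and> card B = vec.dim (eigenspace (form_matrix h) \<mu>)
      \<and> (\<forall>u\<in>B. \<forall>v\<in>B. complex_of_real s * h u v = (if u = v then 1 else 0))"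
      using eigenspace_form_sgn[OF h _ _ \<mu>(2)] \<mu>(1)
      by (intro orthonormal_set_exists subspace_eigenspace) auto
  qed
  then obtain B where B: "\<And>\<mu>. \<mu> \<in> I \<Longrightarrow> B \<mu> \<subseteq> eigenspace (form_matrix h) \<mu>"
    "\<And>\<mu>. \<mu> \<in> I \<Longrightarrow> finite (B \<mu>)"
    "\<And>\<mu>. \<mu> \<in> I \<Longrightarrow> card (B \<mu>) = vec.dim (eigenspace (form_matrix h) \<mu>)"
    "\<And>\<mu> u v. \<mu> \<in> I \<Longrightarrow> u \<in> B \<mu> \<Longrightarrow> v \<in> B \<mu> \<Longrightarrow> complex_of_real s * h u v = (if u = v then 1 else 0)"
    by metis
  have form: "complex_of_real s * h u v = (if u = v then 1 else 0)"
    if "\<mu> \<in> I" "\<nu> \<in> I" "u \<in> B \<mu>" "v \<in> B \<nu>" for \<mu> \<nu> u v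
  proof (cases "\<mu> = \<nu>")
    case False
    with that have "h u v = 0"
      using B(1) by (intro eigenspaces_orthogonal[OF h, of _ \<mu> _ \<nu>]) auto
    moreover have "complex_of_real s * h u u = 1"
      using B(4) that by auto
    ultimately show ?thesis
      by auto
  qed (use that B(4) in auto)
  \<comment> \<open>A nonzero sign is 1 or -1. Multiplying by \<open>s\<close> once more turns the
    relations for \<open>s * h\<close> into relations for \<open>h\<close>.\<close>
  have ss: "s * s = 1" if "\<mu> \<in> I" for \<mu>
  proof -
    have "sgn \<mu> = s"
      using s(1) that by (simp add: I_def)
    with s(2) show ?thesis
      by (auto simp: sgn_if split: if_splits)
  qed
  show ?thesis
  proof (rule that[of "\<Union>\<mu>\<in>I. B \<mu>"])
    show "finite (\<Union>\<mu>\<in>I. B \<mu>)"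
      using fin B(2) by blast
    have "B \<mu> \<inter> B \<nu> = {}" if "\<mu> \<in> I" "\<nu> \<in> I" "\<mu> \<noteq> \<nu>" for \<mu> \<nu>
    proof -
      have False if u: "u \<in> B \<mu>" "u \<in> B \<nu>" for u
      proof -
        have "h u u = 0"
          using B(1) u \<open>\<mu> \<in> I\<close> \<open>\<nu> \<in> I\<close> \<open>\<mu> \<noteq> \<nu>\<close>
          by (intro eigenspaces_orthogonal[OF h, of _ \<mu> _ \<nu>]) auto
        with form[OF \<open>\<mu> \<in> I\<close> \<open>\<nu> \<in> I\<close> u] show False
          by simp
      qed
      then show ?thesis
        by blast
    qed
    then show "card (\<Union>\<mu>\<in>I. B \<mu>) = eigenvalue_count h S"
      unfolding count using fin B(2,3) by (subst card_UN_disjoint) auto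
    show "(\<Union>\<mu>\<in>I. B \<mu>) \<subseteq> (\<Union>\<mu>\<in>S. eigenspace (form_matrix h) \<mu>)"
      using B(1) unfolding I_def by blast
    fix u v
    assume "u \<in> (\<Union>\<mu>\<in>I. B \<mu>)" "v \<in> (\<Union>\<mu>\<in>I. B \<mu>)"
    then obtain \<mu> \<nu> where I: "\<mu> \<in> I" "\<nu> \<in> I" "u \<in> B \<mu>" "v \<in> B \<nu>"
      by blast
    have "complex_of_real (s * s) * h u v = complex_of_real s * (if u = v then 1 else 0)"
      using form[OF I] by (simp add: mult.assoc)
    then show "h u v = (if u = v then complex_of_real s else 0)"
      using ss[OF I(1)] by auto
  qed
qed

text \<open>Pairing with an element of \<open>B\<close> reads off its coefficient. This gives
  independence, hence spanning because there are as many vectors as dimensions, and then the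
  coefficients of \<open>x\<close>.\<close>

lemma orthogonal_expansion:
  fixes h :: "complex^'m \<Rightarrow> complex^'m \<Rightarrow> complex"
  assumes h: "hermitian_form h" and B: "finite B" "card B = CARD('m)"
    and orth: "\<And>u v. u \<in> B \<Longrightarrow> v \<in> B \<Longrightarrow> u \<noteq> v \<Longrightarrow> h u v = 0"
    and unit: "\<And>u. u \<in> B \<Longrightarrow> h u u \<noteq> 0"
  shows "x = (\<Sum>b\<in>B. (h x b / h b b) *s b)"
proof -
  have coeff: "h (\<Sum>b\<in>B. c b *s b) b' = c b' * h b' b'" if "b' \<in> B" for c b'
  proof -
    have "h (\<Sum>b\<in>B. c b *s b) b' = (\<Sum>b\<in>B. if b = b' then c b' * h b' b' else 0)"
      unfolding hermitian_form_sum[OF h] hermitian_form_simps(3)[OF h]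
      using that orth by (intro sum.cong) auto
    then show ?thesis
      using that B(1) by simp
  qed
  have "vec.independent B"
  proof (subst vec.independent_explicit, intro conjI allI impI ballI)
    fix c v
    assume "(\<Sum>v\<in>B. c v *s v) = 0" "v \<in> B"
    with coeff[of v c] unit[of v] show "c v = 0"
      by (simp add: hermitian_form_simps[OF h])
  qed (fact B(1))
  then have "UNIV \<subseteq> vec.span B"
    using vec.card_eq_dim[of B UNIV] B by (simp add: vec_dim_card del: vec.dim_UNIV)
  then obtain c where c: "x = (\<Sum>b\<in>B. c b *s b)"
    unfolding vec.span_finite[OF B(1)] by blast
  have "c b *s b = (h x b / h b b) *s b" if "b \<in> B" for b
    using coeff[OF that, of c] unit[OF that] unfolding c[symmetric] by simp
  then have "(\<Sum>b\<in>B. c b *s b) = (\<Sum>b\<in>B. (h x b / h b b) *s b)"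
    by (rule sum.cong[OF refl])
  with c show ?thesis
    by (rule trans)
qed

text \<open>The two counts add up to the dimension, so negative and positive eigenvectors together
  form a basis. The index type \<open>'n option\<close> accommodates the one additional positive
  vector.\<close>

lemma signature_basis:
  fixes h :: "complex^'m \<Rightarrow> complex^'m \<Rightarrow> complex"
  assumes h: "hermitian_form h" and dim: "CARD('m) = 2 * CARD('n::finite) + 1"
    and neg: "eigenvalue_count h {..<0} = CARD('n::finite)"
    and pos: "eigenvalue_count h {0<..} = CARD('n::finite) + 1"
  obtains P :: "('n::finite) option \<Rightarrow> complex^'m" and N :: "'n::finite \<Rightarrow> complex^'m" where
    "\<And>i j. h (P i) (P j) = (if i = j then 1 else 0)"
    "\<And>i j. h (N i) (N j) = (if i = j then - 1 else 0)"
    "\<And>i j. h (P i) (N j) = 0" "\<And>i j. h (N i) (P j) = 0"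
    "\<And>x. x = (\<Sum>i\<in>UNIV. h x (P i) *s P i) - (\<Sum>i\<in>UNIV. h x (N i) *s N i)"
proof -
  obtain B where B: "finite B" "card B = CARD('n)"
    "B \<subseteq> (\<Union>\<mu>\<in>{..<0}. eigenspace (form_matrix h) \<mu>)"
    "\<And>u v. u \<in> B \<Longrightarrow> v \<in> B \<Longrightarrow> h u v = (if u = v then - 1 else 0)"
    using neg by (rule_tac eigenvalue_count_basis[OF h, of "{..<0}" "-1"]) auto
  obtain C where C: "finite C" "card C = CARD('n) + 1"
    "C \<subseteq> (\<Union>\<mu>\<in>{0<..}. eigenspace (form_matrix h) \<mu>)"
    "\<And>u v. u \<in> C \<Longrightarrow> v \<in> C \<Longrightarrow> h u v = (if u = v then 1 else 0)"
    using pos by (rule_tac eigenvalue_count_basis[OF h, of "{0<..}" 1]) auto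
  have BC: "h u v = 0" "h v u = 0" if uv: "u \<in> B" "v \<in> C" for u v
  proof -
    obtain \<mu> \<nu> where "\<mu> < 0" "0 < \<nu>" "u \<in> eigenspace (form_matrix h) \<mu>" "v \<in> eigenspace (form_matrix h) \<nu>"
      using uv B(3) C(3) by blast
    then show "h u v = 0" "h v u = 0"
      using eigenspaces_orthogonal[OF h] by fastforce+
  qed
  have disj: "B \<inter> C = {}"
    using B(4) BC by fastforce
  obtain N where N: "bij_betw N (UNIV :: 'n set) B"
    using finite_same_card_bij[of "UNIV :: 'n set" B] B(1,2) by auto
  obtain P where P: "bij_betw P (UNIV :: 'n option set) C"
    using finite_same_card_bij[of "UNIV :: 'n option set" C] C(1,2)
    by (auto simp: UNIV_option_conv card_image)
  have NB: "N i \<in> B" "N i = N j \<longleftrightarrow> i = j" and PC: "P a \<in> C" "P a = P b \<longleftrightarrow> a = b" for i j a b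
    using N P by (auto simp: bij_betw_def inj_on_def)
  have "x = (\<Sum>i\<in>UNIV. h x (P i) *s P i) - (\<Sum>i\<in>UNIV. h x (N i) *s N i)" for x
  proof -
    have "x = (\<Sum>b\<in>B \<union> C. (h x b / h b b) *s b)"
      using B C disj dim BC
      by (intro orthogonal_expansion[OF h]) (auto simp: card_Un_disjoint)
    also have "\<dots> = (\<Sum>b\<in>B. (h x b / h b b) *s b) + (\<Sum>b\<in>C. (h x b / h b b) *s b)"
      using B(1) C(1) disj by (rule sum.union_disjoint)
    \<comment> \<open>The divisor \<open>h b b\<close> is -1 on \<open>B\<close> and 1 on
      \<open>C\<close>.\<close>
    also have "\<dots> = (\<Sum>b\<in>B. - (h x b *s b)) + (\<Sum>b\<in>C. h x b *s b)"
      by (simp add: B(4) C(4) vec.scale_minus_left)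
    also have "\<dots> = (\<Sum>i\<in>UNIV. h x (P i) *s P i) - (\<Sum>i\<in>UNIV. h x (N i) *s N i)"
      by (simp add: sum_negf sum.reindex_bij_betw[OF N, of "\<lambda>b. h x b *s b", symmetric]
          sum.reindex_bij_betw[OF P, of "\<lambda>b. h x b *s b", symmetric])
    finally show ?thesis .
  qed
  then show ?thesis
    by (intro that[of P N]) (auto simp: B(4)[OF NB(1) NB(1)] C(4)[OF PC(1) PC(1)] NB(2) PC(2) BC NB(1) PC(1))
qed

section \<open>Existence of adapted coordinates\<close>

lemma sum_option: "(\<Sum>a\<in>UNIV. f a) = f None + (\<Sum>i\<in>UNIV. f (Some i))" for f :: "'n::finite option \<Rightarrow> 'b::comm_monoid_add"
  unfolding UNIV_option_conv by (subst sum.insert) (auto simp: sum.reindex)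

text \<open>With \<open>h'\<close> free, relabelling suffices: \<open>e\<close> identifies
  \<open>'m\<close> with two copies of \<open>'n\<close> and one extra index, and \<open>h'\<close>
  is taken to be the normal form itself.\<close>

lemma adapted_coordinates_exist:
  fixes g :: "complex^'n \<Rightarrow> complex^'n \<Rightarrow> complex"
  assumes dim: "CARD('m::finite) = 2 * CARD('n) + 1"
    and g: "hermitian_form g" "nondegenerate_form g"
  shows "\<exists>(h' :: complex^'m \<Rightarrow> complex^'m \<Rightarrow> complex) X Y R E. adapted_coordinates g h' X Y R E"
proof -
  obtain e :: "('n + 'n) option \<Rightarrow> 'm" where e: "bij e"
    using finite_same_card_bij[of "UNIV :: ('n + 'n) option set" "UNIV :: 'm set"] dim by auto
  define X :: "complex^'m \<Rightarrow> complex^'n" where "X u = (\<chi> j. u $ e (Some (Inl j)))" for u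
  define Y :: "complex^'m \<Rightarrow> complex^'n" where "Y u = (\<chi> j. u $ e (Some (Inr j)))" for u
  define R :: "complex^'m \<Rightarrow> complex" where "R u = u $ e None" for u
  define E :: "complex^'n \<Rightarrow> complex^'n \<Rightarrow> complex \<Rightarrow> complex^'m" where
    "E x y r = (\<chi> i. case inv e i of None \<Rightarrow> r | Some (Inl j) \<Rightarrow> x $ j | Some (Inr j) \<Rightarrow> y $ j)" for x y r
  have inv: "inv e (e a) = a" "e (inv e i) = i" for a i
    using e by (simp_all add: bij_is_inj bij_is_surj surj_f_inv_f)
  have E: "E (X u) (Y u) (R u) $ i = u $ i" for u i
    using inv(2)[of i] by (auto simp: E_def X_def Y_def R_def split: option.split sum.split)
  have "adapted_coordinates g (\<lambda>u v. 4 * \<i> * (g (Y u) (X v) - g (X u) (Y v)) + 2 * R u * cnj (R v)) X Y R E"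
    by unfold_locales (use g E in \<open>simp_all add: X_def Y_def R_def vec_eq_iff, simp_all add: E_def inv\<close>)
  then show ?thesis
    by blast
qed

text \<open>Each pair \<open>P (Some j)\<close>, \<open>N j\<close> spans a hyperbolic plane, with
  isotropic coordinates given by multiples of the difference and the sum of the two coefficients;
  \<open>P None\<close> supplies \<open>R\<close>. The sign \<open>\<delta> j\<close> is absorbed
  into \<open>Y\<close>, so the signature of \<open>h\<close> is the same for every choice of
  signs.\<close>

lemma adapted_coordinates_signature:
  fixes \<delta> :: "'n::finite \<Rightarrow> real" and h :: "complex^'m \<Rightarrow> complex^'m \<Rightarrow> complex"
  assumes \<delta>: "\<And>j. \<delta> j = 1 \<or> \<delta> j = - 1" and dim: "CARD('m) = 2 * CARD('n) + 1"
    and h: "hermitian_form h"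
    and count: "eigenvalue_count h {..<0} = CARD('n)" "eigenvalue_count h {0<..} = CARD('n) + 1"
  shows "\<exists>X Y R E. adapted_coordinates (\<lambda>(z :: complex^'n) u. \<Sum>j\<in>UNIV. complex_of_real (\<delta> j) * z $ j * cnj (u $ j)) h X Y R E"
proof -
  obtain P :: "'n option \<Rightarrow> complex^'m" and N :: "'n \<Rightarrow> complex^'m" where
    PP: "\<And>i j. h (P i) (P j) = (if i = j then 1 else 0)"
    and NN: "\<And>i j. h (N i) (N j) = (if i = j then - 1 else 0)"
    and PN: "\<And>i j. h (P i) (N j) = 0" and NP: "\<And>i j. h (N i) (P j) = 0"
    and expand: "\<And>x. x = (\<Sum>i\<in>UNIV. h x (P i) *s P i) - (\<Sum>i\<in>UNIV. h x (N i) *s N i)"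
    using signature_basis[OF h dim count] by blast
  define g where "g = (\<lambda>(z :: complex^'n) u. \<Sum>j\<in>UNIV. complex_of_real (\<delta> j) * z $ j * cnj (u $ j))"
  \<comment> \<open>\<open>s * s = 2\<close> compensates the factor 2 of the \<open>R\<close> term,
    and \<open>(2 * s)^2 = 8\<close> the factor 4 of the cross terms, in which each product occurs
    twice.\<close>
  define s where "s = complex_of_real (sqrt 2)"
  have s: "s \<noteq> 0" "s * s = 2" "cnj s = s" "s * (s * a) = 2 * a" for a
  proof -
    show "s \<noteq> 0" "cnj s = s"
      by (simp_all add: s_def)
    show *: "s * s = 2"
      unfolding s_def by (simp flip: of_real_mult)
    show "s * (s * a) = 2 * a"
      by (simp add: * flip: mult.assoc)
  qed
  have \<delta>2: "complex_of_real (\<delta> j) * complex_of_real (\<delta> j) = 1"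
    "complex_of_real (\<delta> j) * (complex_of_real (\<delta> j) * a) = a" for j a
    using \<delta>[of j] by auto
  define X where "X u = (\<chi> j. (h u (P (Some j)) - h u (N j)) / (2 * s))" for u
  define Y where "Y u = (\<chi> j. - \<i> * \<delta> j * (h u (P (Some j)) + h u (N j)) / (2 * s))" for u
  define R where "R u = h u (P None) / s" for u
  \<comment> \<open>Found by solving the definitions of \<open>X\<close>, \<open>Y\<close>,
    \<open>R\<close> for the pairings with \<open>P\<close> and \<open>N\<close>. The coefficient of
    \<open>N j\<close> is minus the pairing with \<open>N j\<close>, because
    \<open>h (N j) (N j) = - 1\<close>.\<close>
  define E where "E x y r = (s * r) *s P None + (\<Sum>j\<in>UNIV. (s * (x $ j + \<i> * \<delta> j * y $ j)) *s P (Some j))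
      + (\<Sum>j\<in>UNIV. (s * (x $ j - \<i> * \<delta> j * y $ j)) *s N j)" for x y :: "complex^'n" and r
  have hE: "h (E x y r) (P None) = s * r"
    "h (E x y r) (P (Some j)) = s * (x $ j + \<i> * \<delta> j * y $ j)"
    "h (E x y r) (N j) = - (s * (x $ j - \<i> * \<delta> j * y $ j))" for x y r j
    by (simp_all add: E_def hermitian_form_simps[OF h] hermitian_form_sum[OF h] PP NN PN NP
        if_distrib cong: if_cong)
  have "adapted_coordinates g h X Y R E"
  proof
    show "hermitian_form g"
      unfolding hermitian_form_def g_def
      by (simp add: sum.distrib sum_distrib_left algebra_simps)
    show "nondegenerate_form g"
      unfolding nondegenerate_form_def
    proof (intro allI impI)
      fix x
      assume *: "\<forall>u. g x u = 0"
      have "g x (axis j 1) = \<delta> j * x $ j" for j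
        by (simp add: g_def axis_def if_distrib cong: if_cong)
      with * have "\<delta> j * x $ j = 0" for j
        by metis
      moreover have "\<delta> j \<noteq> 0" for j
        using \<delta>[of j] by auto
      ultimately show "x = 0"
        by (simp add: vec_eq_iff)
    qed
    fix u v :: "complex^'m"
    have "h u v = (\<Sum>i\<in>UNIV. h u (P i) * h (P i) v) - (\<Sum>i\<in>UNIV. h u (N i) * h (N i) v)"
      by (subst (1) expand[of u]) (simp add: hermitian_form_simps[OF h] hermitian_form_sum[OF h])
    also have "\<dots> = h u (P None) * cnj (h v (P None)) +
        (\<Sum>j\<in>UNIV. h u (P (Some j)) * cnj (h v (P (Some j))) - h u (N j) * cnj (h v (N j)))"
      unfolding sum_option hermitian_form_cnj[OF h, of "P _" v] hermitian_form_cnj[OF h, of "N _" v]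
      by (simp add: sum_subtractf)
    also have "h u (P None) * cnj (h v (P None)) = 2 * R u * cnj (R v)"
      by (simp add: R_def s field_simps)
    \<comment> \<open>Termwise this is \<open>(a + b) * cnj (c - d) + (a - b) * cnj (c + d) = 2 * (a
      * cnj c - b * cnj d)\<close>, with \<open>a\<close>, \<open>b\<close> the pairings of
      \<open>u\<close> and \<open>c\<close>, \<open>d\<close> those of \<open>v\<close>.\<close>
    also have "(\<Sum>j\<in>UNIV. h u (P (Some j)) * cnj (h v (P (Some j))) - h u (N j) * cnj (h v (N j)))
        = 4 * \<i> * (g (Y u) (X v) - g (X u) (Y v))"
      unfolding g_def sum_subtractf[symmetric] sum_distrib_left
    proof (rule sum.cong)
      fix j
      show "h u (P (Some j)) * cnj (h v (P (Some j))) - h u (N j) * cnj (h v (N j)) =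
          4 * \<i> * (\<delta> j * Y u $ j * cnj (X v $ j) - \<delta> j * X u $ j * cnj (Y v $ j))"
        using s by (simp add: X_def Y_def \<delta>2 divide_simps) (simp add: algebra_simps \<delta>2 s)
    qed simp
    finally show "h u v = 4 * \<i> * (g (Y u) (X v) - g (X u) (Y v)) + 2 * R u * cnj (R v)"
      by simp
    show "X (u + v) = X u + X v" "Y (u + v) = Y u + Y v" "R (u + v) = R u + R v"
      by (simp_all add: X_def Y_def R_def vec_eq_iff hermitian_form_simps[OF h] add_divide_distrib
          diff_divide_distrib algebra_simps)
    show "X (c *s u) = c *s X u" "Y (c *s u) = c *s Y u" "R (c *s u) = c * R u" for c
      by (simp_all add: X_def Y_def R_def vec_eq_iff hermitian_form_simps[OF h] add_divide_distrib
          diff_divide_distrib algebra_simps)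
    show "X (E x y r) = x" "Y (E x y r) = y" "R (E x y r) = r" for x y r
      using s by (simp_all add: X_def Y_def R_def vec_eq_iff hE field_simps \<delta>2)
    have "s * (X u $ j + \<i> * \<delta> j * Y u $ j) = h u (P (Some j))"
      "s * (X u $ j - \<i> * \<delta> j * Y u $ j) = - h u (N j)" "s * R u = h u (P None)" for j
      using s(1) by (simp_all add: X_def Y_def R_def field_simps \<delta>2)
    then have "E (X u) (Y u) (R u) = (\<Sum>i\<in>UNIV. h u (P i) *s P i) - (\<Sum>i\<in>UNIV. h u (N i) *s N i)"
      by (simp add: E_def sum_option sum_negf vec.scale_minus_left)
    with expand[of u] show "E (X u) (Y u) (R u) = u"
      by simp
  qed
  then show ?thesis
    unfolding g_def by blast
qed

theorem theorem1p4:
  assumes dim: "CARD('m::finite) = 2 * CARD('n::finite) + 1"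
  shows
    "(\<forall>h :: complex^'n \<Rightarrow> complex^'n \<Rightarrow> complex.
        hermitian_form h \<and> nondegenerate_form h \<longrightarrow>
        (\<exists>(M' :: ((complex^'m) \<times> complex) set) (H :: (complex^'n) \<times> complex \<Rightarrow> (complex^'m) \<times> complex).
           levi_nondegenerate M' \<and> embedding H \<and> poly_map_of_degree 2 H \<and>
           H ` hyperquadric h \<subseteq> M' \<and>
           \<not> (\<exists>V. open V \<and> hyperquadric h \<subseteq> V \<and> H ` V \<subseteq> M') \<and>
           \<not> (\<exists>A. real_analytic_subset A (hyperquadric h) \<and> A \<noteq> hyperquadric h \<and>
                  (\<forall>p \<in> hyperquadric h - A. transversal_at H M' p))))
     \<and>
     (\<forall>(\<delta> :: 'n \<Rightarrow> real) (h' :: complex^'m \<Rightarrow> complex^'m \<Rightarrow> complex) M.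
        (\<forall>j. \<delta> j = 1 \<or> \<delta> j = -1) \<and> M = {Z. rho \<delta> Z = 0} \<and>
        hermitian_form h' \<and> nondegenerate_form h' \<and>
        eigenvalue_count h' {..<0} = CARD('n) \<and> eigenvalue_count h' {0<..} = CARD('n) + 1 \<longrightarrow>
        (\<exists>(H :: (complex^'n) \<times> complex \<Rightarrow> (complex^'m) \<times> complex) (\<phi> :: complex^'m \<Rightarrow> real) M'.
           embedding H \<and> poly_map_of_degree 2 H \<and> real_bihomogeneous 2 2 \<phi> \<and>
           (\<forall>Z. rho' h' \<phi> (H Z) = - 4 * (rho \<delta> Z)\<^sup>2) \<and>
           M' = {Z'. rho' h' \<phi> Z' = 0} \<and>
           levi_nondegenerate M' \<and> H ` M \<subseteq> M' \<and>
           \<not> (\<exists>V. open V \<and> M \<subseteq> V \<and> H ` V \<subseteq> M') \<and>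
           \<not> (\<exists>A. real_analytic_subset A M \<and> A \<noteq> M \<and> (\<forall>p \<in> M - A. transversal_at H M' p))))"
proof (intro conjI allI impI; elim conjE)
  fix h :: "complex^'n \<Rightarrow> complex^'n \<Rightarrow> complex"
  assume "hermitian_form h" "nondegenerate_form h"
  then obtain h' :: "complex^'m \<Rightarrow> complex^'m \<Rightarrow> complex" and X Y R E where
    "adapted_coordinates h h' X Y R E"
    using adapted_coordinates_exist[OF dim] by blast
  then interpret adapted_coordinates h h' X Y R E .
  show "\<exists>(M' :: ((complex^'m) \<times> complex) set) (H :: (complex^'n) \<times> complex \<Rightarrow> (complex^'m) \<times> complex).
           levi_nondegenerate M' \<and> embedding H \<and> poly_map_of_degree 2 H \<and>
           H ` hyperquadric h \<subseteq> M' \<and>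
           \<not> (\<exists>V. open V \<and> hyperquadric h \<subseteq> V \<and> H ` V \<subseteq> M') \<and>
           \<not> (\<exists>A. real_analytic_subset A (hyperquadric h) \<and> A \<noteq> hyperquadric h \<and>
                  (\<forall>p \<in> hyperquadric h - A. transversal_at H M' p))"
    by (intro exI[of _ target] exI[of _ H] conjI levi_nondegenerate_target embedding_H poly_map_of_degree_H
        H_hyperquadric no_neighbourhood_into_target not_generically_transversal)
next
  fix \<delta> :: "'n \<Rightarrow> real" and h' :: "complex^'m \<Rightarrow> complex^'m \<Rightarrow> complex" and M
  let ?g = "\<lambda>(z :: complex^'n) u. \<Sum>j\<in>UNIV. complex_of_real (\<delta> j) * z $ j * cnj (u $ j)"
  assume "\<forall>j. \<delta> j = 1 \<or> \<delta> j = -1" and M: "M = {Z. rho \<delta> Z = 0}"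
    and "hermitian_form h'" "eigenvalue_count h' {..<0} = CARD('n)" "eigenvalue_count h' {0<..} = CARD('n) + 1"
  then obtain X Y R E where "adapted_coordinates ?g h' X Y R E"
    using adapted_coordinates_signature[OF _ dim] by blast
  then interpret adapted_coordinates ?g h' X Y R E .
  \<comment> \<open>Matches \<open>?g\<close> with \<open>rho \<delta>\<close>, so that
    \<open>M\<close> is the hyperquadric of \<open>?g\<close> and the results on adapted coordinates
    apply to it.\<close>
  have "Re (?g z z) = (\<Sum>j\<in>UNIV. \<delta> j * (cmod (z $ j))\<^sup>2)" for z
    by (simp add: mult.assoc complex_mult_cnj cmod_power2)
  then have rho: "rho \<delta> (z, w) = Im w - Re (?g z z)" for z w
    by (simp add: rho_def)
  then have quadric: "M = hyperquadric ?g"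
    unfolding M hyperquadric_def by auto
  have "rho' h' \<phi> (H Z) = - 4 * (rho \<delta> Z)\<^sup>2" for Z
    by (cases Z) (simp only: rho'_H rho)
  then show "\<exists>(H :: (complex^'n) \<times> complex \<Rightarrow> (complex^'m) \<times> complex) (\<phi> :: complex^'m \<Rightarrow> real) M'.
           embedding H \<and> poly_map_of_degree 2 H \<and> real_bihomogeneous 2 2 \<phi> \<and>
           (\<forall>Z. rho' h' \<phi> (H Z) = - 4 * (rho \<delta> Z)\<^sup>2) \<and>
           M' = {Z'. rho' h' \<phi> Z' = 0} \<and>
           levi_nondegenerate M' \<and> H ` M \<subseteq> M' \<and>
           \<not> (\<exists>V. open V \<and> M \<subseteq> V \<and> H ` V \<subseteq> M') \<and>
           \<not> (\<exists>A. real_analytic_subset A M \<and> A \<noteq> M \<and> (\<forall>p \<in> M - A. transversal_at H M' p))"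
    unfolding quadric
    by (intro exI[of _ H] exI[of _ \<phi>] exI[of _ target] conjI allI refl embedding_H poly_map_of_degree_H
        real_bihomogeneous_square hermitian_k levi_nondegenerate_target H_hyperquadric
        no_neighbourhood_into_target not_generically_transversal)
qed

end
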